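(* For a Krull domain $A$, consider the following assertions: (i) The divisor class group of $A$ has order $\le 2$. (ii) $A$ is a half-factorial domain (HFD). (iii) $A$ is a unique factorization domain or $A$ has at least one good atom that is not a prime element. Then (i) $\Rightarrow$ (ii) $\Rightarrow$ (iii). Moreover, if each divisor class of $A$ contains a height-one prime ideal, then all three assertions are equivalent.
   Context: An atom (irreducible element) of a domain $A$ is a nonzero nonunit that is not a product of two nonunits of $A$. $A$ is atomic if every nonzero nonunit of $A$ is a product of finitely many atoms (Krull domains are atomic). $A$ is a half-factorial domain (HFD) if $A$ is atomic and, for each nonzero nonunit $x\in A$, all factorizations of $x$ into atoms have the same length (number of factors). The divisor class group of a Krull domain is the group of divisorial fractional ideals (under $v$-multiplication) modulo the principal fractional ideals; its elements are the divisor classes. Let $A$ be an atomic domain. An atomic equality is an equality $a_1\cdots a_n=b_1\cdots b_m$ in which all factors $a_i,b_j$ are atoms of $A$ ($n,m\ge 1$). It is balanced if $n=m$ and unbalanced if $n\ne m$. It is irredundant if no proper subproduct of the $a$'s is associated to a proper subproduct of the $b$'s, i.e. $\prod_{i\in I}a_i$ is not associated (equal up to a unit factor of $A$) to $\prod_{j\in J}b_j$ for all nonempty proper subsets $I\subsetneq\{1,\dots,n\}$, $J\subsetneq\{1,\dots,m\}$. A bad atom is an atom that appears (as one of the $a_i$ or $b_j$) in some irredundant unbalanced atomic equality. A good atom is an atom that is not bad. *)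

theory Defs
  imports
    "HOL-Library.Extended_Nat"
    "HOL-Computational_Algebra.Polynomial_Factorial"
    "HOL-Algebra.Coset"
begin

section \<open>Krull domains\<close>

text \<open>
  Throughout, a domain is a type \<open>'a\<close> of class \<open>idom\<close>, its quotient field is \<open>'a fract\<close>,
  and the domain is identified with the subset \<open>range to_fract\<close> of the quotient field.
\<close>

text \<open>
  The usual convention that \<open>v 0\<close> is infinite is rendered by leaving the value at \<open>0\<close> unconstrained.
  A discrete valuation is normalized: its value group is the group of all integers.
\<close>

definition discrete_valuation :: "('k::field \<Rightarrow> int) \<Rightarrow> bool" where
  "discrete_valuation v \<longleftrightarrow>
     (\<forall>x y. x \<noteq> 0 \<longrightarrow> y \<noteq> 0 \<longrightarrow> v (x * y) = v x + v y) \<and>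
     (\<forall>x y. x \<noteq> 0 \<longrightarrow> y \<noteq> 0 \<longrightarrow> x + y \<noteq> 0 \<longrightarrow> min (v x) (v y) \<le> v (x + y)) \<and>
     v ` (- {0}) = UNIV"

text \<open>
  A Krull domain is an intersection of discrete valuation rings of its quotient field, with finite
  character.  The family may be empty, so fields are Krull domains.
\<close>

definition krull_domain :: "'a::idom itself \<Rightarrow> bool" where
  "krull_domain TYPE('a) \<longleftrightarrow>
     (\<exists>V :: ('a fract \<Rightarrow> int) set.
        (\<forall>v\<in>V. discrete_valuation v) \<and>
        range (to_fract :: 'a \<Rightarrow> 'a fract) = {x. x = 0 \<or> (\<forall>v\<in>V. 0 \<le> v x)} \<and>
        (\<forall>x. x \<noteq> 0 \<longrightarrow> finite {v \<in> V. v x \<noteq> 0}))"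


section \<open>The divisor class group\<close>

definition fract_scale :: "'a::idom \<Rightarrow> 'a fract \<Rightarrow> 'a fract" where
  "fract_scale a x = to_fract a * x"

lemma module_fract_scale: "module fract_scale"
  by unfold_locales (simp_all add: fract_scale_def algebra_simps)

definition fractional_ideal :: "'a::idom fract set \<Rightarrow> bool" where
  "fractional_ideal I \<longleftrightarrow>
     module.subspace fract_scale I \<and> I \<noteq> {0} \<and>
     (\<exists>d. d \<noteq> 0 \<and> fract_scale d ` I \<subseteq> range to_fract)"

definition ideal_inverse :: "'a::idom fract set \<Rightarrow> 'a fract set" where
  "ideal_inverse I = {x. \<forall>y\<in>I. x * y \<in> range to_fract}"

definition v_closure :: "'a::idom fract set \<Rightarrow> 'a fract set" where
  "v_closure I = ideal_inverse (ideal_inverse I)"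

definition divisorial :: "'a::idom fract set \<Rightarrow> bool" where
  "divisorial I \<longleftrightarrow> fractional_ideal I \<and> v_closure I = I"

definition ideal_product :: "'a::idom fract set \<Rightarrow> 'a fract set \<Rightarrow> 'a fract set" where
  "ideal_product I J = module.span fract_scale {x * y | x y. x \<in> I \<and> y \<in> J}"

definition principal_ideal :: "'a::idom fract \<Rightarrow> 'a fract set" where
  "principal_ideal x = range (\<lambda>a. fract_scale a x)"

definition divisor_group :: "'a::idom fract set monoid" where
  "divisor_group =
     \<lparr>carrier = {I. divisorial I},
      mult = (\<lambda>I J. v_closure (ideal_product I J)),
      one = range to_fract\<rparr>"

definition divisor_class_group :: "'a::idom fract set set monoid" where
  "divisor_class_group = divisor_group Mod {principal_ideal x | x. x \<noteq> 0}"


section \<open>Height-one prime ideals\<close>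

definition prime_ideal :: "'a::idom set \<Rightarrow> bool" where
  "prime_ideal P \<longleftrightarrow>
     module.subspace (*) P \<and> P \<noteq> UNIV \<and> (\<forall>a b. a * b \<in> P \<longrightarrow> a \<in> P \<or> b \<in> P)"

definition prime_height :: "'a::idom set \<Rightarrow> enat" where
  "prime_height P =
     (SUP n \<in> {n. \<exists>Q :: nat \<Rightarrow> 'a set. Q n = P \<and> (\<forall>i\<le>n. prime_ideal (Q i)) \<and>
                                       (\<forall>i<n. Q i \<subset> Q (Suc i))}. enat n)"

definition every_class_has_height_one_prime :: "'a::idom itself \<Rightarrow> bool" where
  "every_class_has_height_one_prime TYPE('a) \<longleftrightarrow>
     (\<forall>C \<in> carrier (divisor_class_group :: 'a fract set set monoid).
        \<exists>P :: 'a set. prime_ideal P \<and> prime_height P = 1 \<and> to_fract ` P \<in> C)"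


section \<open>Factorizations into atoms\<close>

text \<open>Atoms are the elements satisfying the library predicate \<^const>\<open>irreducible\<close>.\<close>

definition associated :: "'a::idom \<Rightarrow> 'a \<Rightarrow> bool" where
  "associated x y \<longleftrightarrow> (\<exists>u. u dvd 1 \<and> y = u * x)"

definition factorization_of :: "'a::idom multiset \<Rightarrow> 'a \<Rightarrow> bool" where
  "factorization_of F x \<longleftrightarrow> (\<forall>a \<in># F. irreducible a) \<and> prod_mset F = x"

definition atomic_domain :: "'a::idom itself \<Rightarrow> bool" where
  "atomic_domain TYPE('a) \<longleftrightarrow>
     (\<forall>x::'a. x \<noteq> 0 \<longrightarrow> \<not> x dvd 1 \<longrightarrow> (\<exists>F. factorization_of F x))"

definition half_factorial_domain :: "'a::idom itself \<Rightarrow> bool" where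
  "half_factorial_domain TYPE('a) \<longleftrightarrow>
     atomic_domain TYPE('a) \<and>
     (\<forall>(x::'a) F G. x \<noteq> 0 \<longrightarrow> \<not> x dvd 1 \<longrightarrow>
        factorization_of F x \<longrightarrow> factorization_of G x \<longrightarrow> size F = size G)"

definition unique_factorization_domain :: "'a::idom itself \<Rightarrow> bool" where
  "unique_factorization_domain TYPE('a) \<longleftrightarrow>
     atomic_domain TYPE('a) \<and>
     (\<forall>(x::'a) F G. x \<noteq> 0 \<longrightarrow> \<not> x dvd 1 \<longrightarrow>
        factorization_of F x \<longrightarrow> factorization_of G x \<longrightarrow> rel_mset associated F G)"


section \<open>Good atoms\<close>

definition atomic_equality :: "'a::idom list \<Rightarrow> 'a list \<Rightarrow> bool" where
  "atomic_equality as bs \<longleftrightarrow>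
     as \<noteq> [] \<and> bs \<noteq> [] \<and> (\<forall>a \<in> set as \<union> set bs. irreducible a) \<and> prod_list as = prod_list bs"

definition unbalanced :: "'a list \<Rightarrow> 'a list \<Rightarrow> bool" where
  "unbalanced as bs \<longleftrightarrow> length as \<noteq> length bs"

definition irredundant :: "'a::idom list \<Rightarrow> 'a list \<Rightarrow> bool" where
  "irredundant as bs \<longleftrightarrow>
     (\<forall>I J. I \<noteq> {} \<longrightarrow> I \<subset> {..<length as} \<longrightarrow> J \<noteq> {} \<longrightarrow> J \<subset> {..<length bs} \<longrightarrow>
        \<not> associated (\<Prod>i\<in>I. as ! i) (\<Prod>j\<in>J. bs ! j))"

definition bad_atom :: "'a::idom \<Rightarrow> bool" where
  "bad_atom a \<longleftrightarrow> irreducible a \<and>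
     (\<exists>as bs. atomic_equality as bs \<and> irredundant as bs \<and> unbalanced as bs \<and>
              a \<in> set as \<union> set bs)"

definition good_atom :: "'a::idom \<Rightarrow> bool" where
  "good_atom a \<longleftrightarrow> irreducible a \<and> \<not> bad_atom a"

end

theory Submission
  imports Defs
begin

text \<open>
  In a Krull domain every integral divisorial ideal is a unique \<open>v\<close>-product of prime divisors:
  complete integral closedness makes containment equivalent to divisibility, and the minimal values
  of the defining valuations give a size that decreases strictly under proper containment.  An atom
  is an element whose divisor has no proper nonempty principal subproduct.

  If there are at most two classes, such a minimal product is a principal prime or a pair of
  nonprincipal primes, so a suitable weight counts atoms.  If there are at least three and every
  class contains a prime, take an atom with prime factors \<open>P\<^sub>1, \<dots>, P\<^sub>n\<close>, \<open>n \<ge> 3\<close>, and primes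
  \<open>Q\<^sub>i\<close> in the inverse classes: the product of the \<open>P\<^sub>i\<close> times the product of the \<open>Q\<^sub>i\<close>
  equals the product of the principal \<open>P\<^sub>i Q\<^sub>i\<close>, an irredundant equality of 2 with \<open>n\<close> atoms.  An atom
  with two prime factors \<open>P P'\<close> occurs on the right-hand side of such an equality for \<open>n = 3\<close>.
\<close>

section \<open>Divisorial ideals\<close>

interpretation fract_module: module fract_scale
  by (rule module_fract_scale)

lemma range_to_fract_mult:
  "x \<in> range to_fract \<Longrightarrow> y \<in> range to_fract \<Longrightarrow> x * y \<in> range to_fract"
  by (metis (no_types, lifting) image_iff rangeI to_fract_mult)

lemma range_to_fract_add:
  "x \<in> range to_fract \<Longrightarrow> y \<in> range to_fract \<Longrightarrow> x + y \<in> range to_fract"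
  by (metis (no_types, lifting) image_iff rangeI to_fract_add)

lemma one_in_range_to_fract: "1 \<in> range to_fract"
  by (metis rangeI to_fract_1)

lemma zero_in_range_to_fract: "0 \<in> range to_fract"
  by (metis rangeI to_fract_0)

lemma fract_scale_mem:
  "module.subspace fract_scale I \<Longrightarrow> x \<in> I \<Longrightarrow> r \<in> range to_fract \<Longrightarrow> r * x \<in> I"
  using fract_module.subspace_scale[of I x] by (auto simp: fract_scale_def)

section \<open>Inverses of sets in the quotient field and the v-closure operator\<close>

lemma ideal_inverse_antimono: "S \<subseteq> T \<Longrightarrow> ideal_inverse T \<subseteq> ideal_inverse S"
  by (auto simp: ideal_inverse_def)

lemma subset_v_closure: "S \<subseteq> v_closure S"
  by (auto simp: v_closure_def ideal_inverse_def mult.commute)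

lemma v_closure_mono: "S \<subseteq> T \<Longrightarrow> v_closure S \<subseteq> v_closure T"
  by (simp add: v_closure_def ideal_inverse_antimono)

text \<open>\<open>ideal_inverse\<close> forms a Galois connection with itself: it reverses
  inclusions and every set lies in its double inverse, so a triple inverse is a single one.\<close>

lemma ideal_inverse_v_closure [simp]: "ideal_inverse (v_closure S) = ideal_inverse S"
  using ideal_inverse_antimono[OF subset_v_closure[of S]] subset_v_closure[of "ideal_inverse S"]
  by (auto simp: v_closure_def)

lemma v_closure_idem [simp]: "v_closure (v_closure S) = v_closure S"
  by (metis ideal_inverse_v_closure v_closure_def)

lemma subspace_ideal_inverse: "module.subspace fract_scale (ideal_inverse S)"
  by (rule fract_module.subspaceI)
     (auto simp: ideal_inverse_def fract_scale_def distrib_right mult.assoc zero_in_range_to_fract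
           intro: range_to_fract_add range_to_fract_mult)

lemma subspace_v_closure: "module.subspace fract_scale (v_closure S)"
  unfolding v_closure_def by (rule subspace_ideal_inverse)

lemma ideal_inverse_range: "ideal_inverse (range to_fract) = range (to_fract :: 'a::idom \<Rightarrow> _)"
  (is "ideal_inverse ?A = ?A")
proof
  show "ideal_inverse ?A \<subseteq> ?A"
  proof
    fix x assume "x \<in> ideal_inverse ?A"
    then have "x * 1 \<in> ?A"
      unfolding ideal_inverse_def using one_in_range_to_fract by blast
    then show "x \<in> ?A" by simp
  qed
  show "?A \<subseteq> ideal_inverse ?A"
    unfolding ideal_inverse_def using range_to_fract_mult by blast
qed

lemma v_closure_range [simp]: "v_closure (range to_fract) = range to_fract"
  by (simp add: v_closure_def ideal_inverse_range)

lemma v_closure_integral: "S \<subseteq> range to_fract \<Longrightarrow> v_closure S \<subseteq> range to_fract"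
  using v_closure_mono v_closure_range by metis

text \<open>The colon rule \<open>A : IJ = (A : J) : I\<close>. It replaces the span in
  \<open>ideal_product\<close> by a condition on products of elements, which is all that v-closures
  of products depend on.\<close>

lemma ideal_inverse_ideal_product:
  "ideal_inverse (ideal_product I J) = {x. \<forall>a\<in>I. x * a \<in> ideal_inverse J}"
proof (rule Set.set_eqI, rule iffI)
  fix x assume x: "x \<in> ideal_inverse (ideal_product I J)"
  have "x * a * b \<in> range to_fract" if "a \<in> I" "b \<in> J" for a b
  proof -
    have "a * b \<in> ideal_product I J"
      unfolding ideal_product_def using that by (intro fract_module.span_base) auto
    then show ?thesis using x by (auto simp: ideal_inverse_def mult.assoc)
  qed
  then show "x \<in> {x. \<forall>a\<in>I. x * a \<in> ideal_inverse J}"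
    by (simp add: ideal_inverse_def)
next
  fix x assume "x \<in> {x. \<forall>a\<in>I. x * a \<in> ideal_inverse J}"
  then have x: "x * (a * b) \<in> range to_fract" if "a \<in> I" "b \<in> J" for a b
    using that by (auto simp: ideal_inverse_def mult.assoc)
  show "x \<in> ideal_inverse (ideal_product I J)"
    unfolding ideal_inverse_def ideal_product_def
  proof (intro CollectI ballI)
    fix y assume "y \<in> module.span fract_scale {x * y |x y. x \<in> I \<and> y \<in> J}"
    then show "x * y \<in> range to_fract"
    proof (induction rule: fract_module.span_induct_alt)
      case base then show ?case by (simp add: zero_in_range_to_fract)
    next
      case (step c u y)
      then have "x * u \<in> range to_fract" using x by blast
      then have "to_fract c * (x * u) \<in> range to_fract"
        by (rule range_to_fract_mult[OF rangeI])
      from range_to_fract_add[OF this step(2)] show ?case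
        by (simp add: fract_scale_def algebra_simps)
    qed
  qed
qed

lemma ideal_product_commute: "ideal_product I J = ideal_product J I"
  unfolding ideal_product_def by (rule arg_cong[where f = "module.span _"]) (auto, (metis mult.commute)+)

lemma ideal_product_base: "a \<in> I \<Longrightarrow> b \<in> J \<Longrightarrow> a * b \<in> ideal_product I J"
  unfolding ideal_product_def by (auto intro!: fract_module.span_base)

lemma ideal_product_subset:
  assumes "\<And>a b. a \<in> I \<Longrightarrow> b \<in> J \<Longrightarrow> a * b \<in> K" "module.subspace fract_scale K"
  shows "ideal_product I J \<subseteq> K"
  unfolding ideal_product_def by (rule fract_module.span_minimal) (use assms in auto)

section \<open>The v-product, which is the multiplication of \<open>divisor_group\<close>\<close>

definition v_product :: "'a::idom fract set \<Rightarrow> 'a fract set \<Rightarrow> 'a fract set" where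
  "v_product I J = v_closure (ideal_product I J)"

lemma v_product_commute: "v_product I J = v_product J I"
  by (simp add: v_product_def ideal_product_commute)

text \<open>By the colon rule the v-product depends on \<open>J\<close> only through
  \<open>ideal_inverse J\<close>, and closing \<open>J\<close> leaves that inverse
  unchanged.\<close>

lemma v_product_v_closure_right: "v_product I (v_closure J) = v_product I J"
  unfolding v_product_def v_closure_def[of "ideal_product _ _"] ideal_inverse_ideal_product by simp

lemma v_product_assoc: "v_product (v_product I J) K = v_product I (v_product J K)"
proof -
  have "v_product (v_product I J) K = v_product K (ideal_product I J)"
    by (metis v_product_commute v_product_def v_product_v_closure_right)
  also have "\<dots> = v_product I (ideal_product J K)"
  proof -
    have "ideal_inverse (ideal_product K (ideal_product I J)) =
        ideal_inverse (ideal_product I (ideal_product J K))"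
    proof -
      have *: "x * k * i * j = x * i * j * k" for x k i j :: "'a fract" by (simp add: mult_ac)
      show ?thesis
        unfolding ideal_inverse_ideal_product by (auto simp: ideal_inverse_def) (metis *)+
    qed
    then show ?thesis by (simp add: v_product_def v_closure_def)
  qed
  also have "\<dots> = v_product I (v_product J K)"
    by (simp add: v_product_def[of J] v_product_v_closure_right)
  finally show ?thesis .
qed

lemma v_product_base: "a \<in> I \<Longrightarrow> b \<in> J \<Longrightarrow> a * b \<in> v_product I J"
  unfolding v_product_def using ideal_product_base subset_v_closure by blast

lemma v_product_subset:
  assumes "\<And>a b. a \<in> I \<Longrightarrow> b \<in> J \<Longrightarrow> a * b \<in> K" "divisorial K"
  shows "v_product I J \<subseteq> K"
proof -
  have "ideal_product I J \<subseteq> K"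
    using assms by (intro ideal_product_subset) (auto simp: divisorial_def fractional_ideal_def)
  then have "v_product I J \<subseteq> v_closure K"
    unfolding v_product_def by (rule v_closure_mono)
  then show ?thesis using assms(2) by (simp add: divisorial_def)
qed

lemma divisorialD:
  assumes "divisorial I"
  shows "module.subspace fract_scale I" "v_closure I = I"
    "\<exists>x\<in>I. x \<noteq> 0" "\<exists>d. d \<noteq> 0 \<and> (\<forall>x\<in>I. to_fract d * x \<in> range to_fract)"
proof -
  show "module.subspace fract_scale I" "v_closure I = I"
    using assms by (auto simp: divisorial_def fractional_ideal_def)
  have "0 \<in> I" by (rule fract_module.subspace_0) fact
  then show "\<exists>x\<in>I. x \<noteq> 0" using assms by (auto simp: divisorial_def fractional_ideal_def)
  show "\<exists>d. d \<noteq> 0 \<and> (\<forall>x\<in>I. to_fract d * x \<in> range to_fract)"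
    using assms by (auto simp: divisorial_def fractional_ideal_def fract_scale_def image_subset_iff)
qed

text \<open>The submodule property comes from \<open>v_closure I = I\<close>, since every v-closure
  is an inverse and inverses are submodules.\<close>

lemma divisorialI:
  assumes "v_closure I = I" "x \<in> I" "x \<noteq> 0" "d \<noteq> 0"
    "\<And>x. x \<in> I \<Longrightarrow> to_fract d * x \<in> range to_fract"
  shows "divisorial I"
  unfolding divisorial_def fractional_ideal_def
  using assms subspace_v_closure[of I] by (auto simp: fract_scale_def image_subset_iff)

lemma divisorial_integralI:
  assumes "v_closure I = I" "x \<in> I" "x \<noteq> 0" "I \<subseteq> range to_fract"
  shows "divisorial I"
  using assms by (intro divisorialI[where d = 1]) auto

lemma divisorial_range: "divisorial (range to_fract)"
  by (rule divisorial_integralI[where x = 1]) (auto simp: one_in_range_to_fract)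

lemma divisorial_v_product:
  assumes "divisorial I" "divisorial J"
  shows "divisorial (v_product I J)"
proof -
  obtain x y where xy: "x \<in> I" "x \<noteq> 0" "y \<in> J" "y \<noteq> 0"
    using assms divisorialD(3) by metis
  obtain d e where d: "d \<noteq> 0" "\<And>x. x \<in> I \<Longrightarrow> to_fract d * x \<in> range to_fract"
    and e: "e \<noteq> 0" "\<And>x. x \<in> J \<Longrightarrow> to_fract e * x \<in> range to_fract"
    using assms divisorialD(4) by metis
  \<comment> \<open>A product of denominators of \<open>I\<close> and \<open>J\<close> lies in the
    inverse of the product, so it is also a denominator for the double inverse.\<close>
  have "to_fract (d * e) \<in> ideal_inverse (ideal_product I J)"
  proof -
    have "to_fract (d * e) * a * b \<in> range to_fract" if "a \<in> I" "b \<in> J" for a b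
      using range_to_fract_mult[OF d(2)[OF that(1)] e(2)[OF that(2)]] by (simp add: mult_ac)
    then show ?thesis unfolding ideal_inverse_ideal_product by (simp add: ideal_inverse_def)
  qed
  then have "to_fract (d * e) * z \<in> range to_fract" if "z \<in> v_product I J" for z
    using that unfolding v_product_def v_closure_def ideal_inverse_def[of "ideal_inverse _"]
    by (subst mult.commute) blast
  moreover have "x * y \<in> v_product I J" using xy by (intro v_product_base)
  moreover have "v_closure (v_product I J) = v_product I J" by (simp add: v_product_def)
  ultimately show ?thesis
    using xy d(1) e(1) by (intro divisorialI[where x = "x * y" and d = "d * e"]) auto
qed

lemma v_product_range:
  assumes "divisorial I"
  shows "v_product (range to_fract) I = I"
proof
  show "v_product (range to_fract) I \<subseteq> I"
    using assms divisorialD(1) fract_scale_mem by (intro v_product_subset) blast+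
  show "I \<subseteq> v_product (range to_fract) I"
    using v_product_base[OF one_in_range_to_fract, of _ I] by auto
qed

section \<open>Principal fractional ideals and scaling\<close>

lemma principal_ideal_eq: "principal_ideal x = (\<lambda>y. x * y) ` range to_fract"
  by (auto simp: principal_ideal_def fract_scale_def mult.commute)

lemma ideal_inverse_times_image:
  assumes "x \<noteq> 0"
  shows "ideal_inverse ((\<lambda>y. x * y) ` S) = (\<lambda>y. inverse x * y) ` ideal_inverse S"
proof (intro Set.set_eqI iffI)
  fix z assume "z \<in> ideal_inverse ((\<lambda>y. x * y) ` S)"
  then have "x * z \<in> ideal_inverse S" by (auto simp: ideal_inverse_def mult_ac)
  then show "z \<in> (\<lambda>y. inverse x * y) ` ideal_inverse S"
    using assms by (auto intro!: image_eqI[of _ _ "x * z"] simp: field_simps)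
qed (use assms in \<open>auto simp: ideal_inverse_def field_simps\<close>)

lemma v_closure_times_image:
  "x \<noteq> 0 \<Longrightarrow> v_closure ((\<lambda>y. x * y) ` S) = (\<lambda>y. x * y) ` v_closure S"
  by (simp add: v_closure_def ideal_inverse_times_image)

lemma divisorial_times_image:
  assumes "x \<noteq> 0" "divisorial I"
  shows "divisorial ((\<lambda>y. x * y) ` I)"
proof -
  obtain z where z: "z \<in> I" "z \<noteq> 0" using assms divisorialD(3) by metis
  obtain d where d: "d \<noteq> 0" "\<And>x. x \<in> I \<Longrightarrow> to_fract d * x \<in> range to_fract"
    using assms divisorialD(4) by metis
  obtain a b where ab: "x = to_fract a / to_fract b" "b \<noteq> 0"
    by (metis Fract_conv_to_fract Fract_cases)
  show ?thesis
  proof (rule divisorialI[where x = "x * z" and d = "b * d"])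
    show "v_closure ((*) x ` I) = (*) x ` I"
      using assms by (simp add: v_closure_times_image divisorialD(2))
    show "to_fract (b * d) * w \<in> range to_fract" if w: "w \<in> (\<lambda>y. x * y) ` I" for w
    proof -
      obtain y where y: "y \<in> I" "w = x * y" using w by auto
      have "to_fract (b * d) * w = to_fract a * (to_fract d * y)"
        using ab y by (simp add: field_simps)
      then show ?thesis using range_to_fract_mult[OF rangeI d(2)[OF y(1)]] by metis
    qed
  qed (use z assms ab d in auto)
qed

lemma divisorial_principal_ideal: "x \<noteq> 0 \<Longrightarrow> divisorial (principal_ideal x)"
  unfolding principal_ideal_eq by (intro divisorial_times_image divisorial_range)

text \<open>A scaled divisorial ideal is again divisorial, so the v-closure adds nothing to the
  product with a principal ideal.\<close>

lemma v_product_principal_ideal: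
  assumes "x \<noteq> 0" "divisorial I"
  shows "v_product (principal_ideal x) I = (\<lambda>y. x * y) ` I"
proof
  show "v_product (principal_ideal x) I \<subseteq> (\<lambda>y. x * y) ` I"
  proof (rule v_product_subset)
    fix a b assume "a \<in> principal_ideal x" "b \<in> I"
    then show "a * b \<in> (\<lambda>y. x * y) ` I"
      using fract_scale_mem[OF divisorialD(1)[OF assms(2)]]
      by (auto simp: principal_ideal_eq mult.assoc)
  qed (use assms divisorial_times_image in blast)
  have "x \<in> principal_ideal x"
    using one_in_range_to_fract by (force simp: principal_ideal_eq)
  then show "(\<lambda>y. x * y) ` I \<subseteq> v_product (principal_ideal x) I"
    by (auto intro: v_product_base)
qed

section \<open>The monoid of integral divisorial ideals\<close>

text \<open>Making the integral divisorial ideals a commutative monoid type gives access to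
  \<open>dvd\<close>, \<open>prod_mset\<close> and multisets of prime factors.\<close>

typedef (overloaded) 'a divisor =
    "{I :: 'a::idom fract set. divisorial I \<and> I \<subseteq> range to_fract}"
  morphisms ideal_of Divisor
  using divisorial_range by auto

setup_lifting type_definition_divisor

instantiation divisor :: (idom) comm_monoid_mult
begin

lift_definition one_divisor :: "'a divisor" is "range to_fract"
  using divisorial_range by auto

lift_definition times_divisor :: "'a divisor \<Rightarrow> 'a divisor \<Rightarrow> 'a divisor" is v_product
proof -
  fix I J :: "'a fract set"
  assume *: "divisorial I \<and> I \<subseteq> range to_fract" "divisorial J \<and> J \<subseteq> range to_fract"
  have "v_product I J \<subseteq> range to_fract"
    using * range_to_fract_mult divisorial_range by (intro v_product_subset) blast+
  with * show "divisorial (v_product I J) \<and> v_product I J \<subseteq> range to_fract"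
    by (simp add: divisorial_v_product)
qed

instance
proof
  fix D E F :: "'a divisor"
  show "D * E * F = D * (E * F)" by transfer (rule v_product_assoc)
  show "D * E = E * D" by transfer (rule v_product_commute)
  show "1 * D = D" by transfer (simp add: v_product_range)
qed

end

lemma divisorial_ideal_of [simp]: "divisorial (ideal_of D)"
  using ideal_of[of D] by simp

lemma ideal_of_integral: "ideal_of D \<subseteq> range to_fract"
  using ideal_of[of D] by simp

lemma ideal_of_obtain_nonzero:
  obtains a where "a \<noteq> 0" "to_fract a \<in> ideal_of D"
  using divisorialD(3)[OF divisorial_ideal_of[of D]] ideal_of_integral[of D]
  by (metis rangeE subsetD to_fract_0)

lemma ideal_of_mult_mem: "x \<in> ideal_of D \<Longrightarrow> y \<in> ideal_of E \<Longrightarrow> x * y \<in> ideal_of (D * E)"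
  by transfer (rule v_product_base)

lemma ideal_of_scale: "x \<in> ideal_of D \<Longrightarrow> to_fract a * x \<in> ideal_of D"
  using fract_scale_mem[OF divisorialD(1)[OF divisorial_ideal_of]] by blast

lemma ideal_of_1: "ideal_of 1 = range to_fract"
  by transfer simp

lemma ideal_of_mult_subset: "ideal_of ((D :: 'a::idom divisor) * E) \<subseteq> ideal_of D"
proof transfer
  fix I J :: "'a fract set"
  assume *: "divisorial I \<and> I \<subseteq> range to_fract" "divisorial J \<and> J \<subseteq> range to_fract"
  show "v_product I J \<subseteq> I"
  proof (rule v_product_subset)
    fix a b assume "a \<in> I" "b \<in> J"
    with * have "b * a \<in> I" by (intro fract_scale_mem divisorialD) auto
    then show "a * b \<in> I" by (simp add: mult.commute)
  qed (use * in simp)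
qed

lemma dvd_imp_subset: "D dvd E \<Longrightarrow> ideal_of E \<subseteq> ideal_of D"
  by (auto simp: dvd_def dest: subsetD[OF ideal_of_mult_subset])

lemma ideal_of_subset_antisym: "ideal_of D \<subseteq> ideal_of E \<Longrightarrow> ideal_of E \<subseteq> ideal_of D \<Longrightarrow> D = E"
  by (metis ideal_of_inject subset_antisym)

lemma divisor_dvd_antisym: "(D::'a::idom divisor) dvd E \<Longrightarrow> E dvd D \<Longrightarrow> D = E"
  by (intro ideal_of_subset_antisym dvd_imp_subset)

lemma divisor_dvd_1_iff [simp]: "(D::'a::idom divisor) dvd 1 \<longleftrightarrow> D = 1"
  using divisor_dvd_antisym[of D 1] by auto

text \<open>The value at \<open>0\<close> is junk; the zero ideal is not a divisor.\<close>

lift_definition prin :: "'a::idom \<Rightarrow> 'a divisor"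
  is "\<lambda>a. if a = 0 then range to_fract else principal_ideal (to_fract a)"
  by (auto simp: divisorial_range divisorial_principal_ideal)
     (auto simp: principal_ideal_eq range_to_fract_mult)

lemma ideal_of_prin: "a \<noteq> 0 \<Longrightarrow> ideal_of (prin a) = (\<lambda>y. to_fract a * y) ` range to_fract"
  by transfer (simp add: principal_ideal_eq)

lemma ideal_of_prin_mult: "a \<noteq> 0 \<Longrightarrow> ideal_of (prin a * D) = (\<lambda>y. to_fract a * y) ` ideal_of D"
  by transfer (simp add: v_product_principal_ideal)

lemma prin_1 [simp]: "prin 1 = 1"
  by transfer (simp add: principal_ideal_eq)

lemma prin_mult: "a \<noteq> 0 \<Longrightarrow> b \<noteq> 0 \<Longrightarrow> prin (a * b) = prin a * prin b"
  by (subst ideal_of_inject[symmetric])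
     (simp add: ideal_of_prin ideal_of_prin_mult image_image mult.assoc)

text \<open>Scaling by a nonzero element is injective. Cancellation of arbitrary divisors in a Krull
  domain is later reduced to this case.\<close>

lemma prin_mult_cancel: "a \<noteq> 0 \<Longrightarrow> prin a * D = prin a * E \<longleftrightarrow> D = E"
  by (auto simp: ideal_of_inject[symmetric] ideal_of_prin_mult inj_image_eq_iff inj_on_def)

lemma ideal_of_prin_subset_iff:
  assumes "a \<noteq> 0"
  shows "ideal_of (prin a) \<subseteq> ideal_of D \<longleftrightarrow> to_fract a \<in> ideal_of D"
proof
  have "to_fract a \<in> ideal_of (prin a)"
    using assms one_in_range_to_fract by (force simp: ideal_of_prin)
  then show "ideal_of (prin a) \<subseteq> ideal_of D \<Longrightarrow> to_fract a \<in> ideal_of D" by auto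
qed (use assms ideal_of_scale[of "to_fract a" D] in \<open>auto simp: ideal_of_prin mult.commute\<close>)

lemma to_fract_mem_prin_iff:
  assumes "b \<noteq> 0"
  shows "to_fract a \<in> ideal_of (prin b) \<longleftrightarrow> b dvd a"
  unfolding ideal_of_prin[OF assms] image_image by (auto simp: dvd_def simp flip: to_fract_mult)

lemma prin_dvd_iff:
  assumes "a \<noteq> 0" "b \<noteq> 0"
  shows "prin a dvd prin b \<longleftrightarrow> a dvd b"
proof
  assume "prin a dvd prin b"
  then show "a dvd b"
    using assms by (metis dvd_imp_subset ideal_of_prin_subset_iff to_fract_mem_prin_iff)
next
  assume "a dvd b"
  then show "prin a dvd prin b" using assms by (auto simp: prin_mult elim!: dvdE)
qed

lemma prin_eq_1_iff: "a \<noteq> 0 \<Longrightarrow> prin a = 1 \<longleftrightarrow> a dvd 1"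
  using prin_dvd_iff[of a 1] by simp

lemma prin_prod_list: "0 \<notin> set as \<Longrightarrow> prin (prod_list as) = prod_list (map prin as)"
  by (induction as) (auto simp: prin_mult prod_list_zero_iff)

section \<open>Divisors of a Krull domain\<close>

lemma ideal_of_mult_mono:
  "ideal_of D \<subseteq> ideal_of E \<Longrightarrow> ideal_of (D * F) \<subseteq> ideal_of (E * F)"
  by transfer (rule v_product_subset; auto intro: divisorial_v_product v_product_base)

lemma ideal_of_Divisor: "divisorial I \<Longrightarrow> I \<subseteq> range to_fract \<Longrightarrow> ideal_of (Divisor I) = I"
  by (simp add: Divisor_inverse)

text \<open>The cofactor is \<open>D\<close> scaled by the inverse of \<open>a\<close>: it stays
  divisorial, and the inclusion makes it integral.\<close>

lemma prin_dvd_if_subset: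
  assumes "a \<noteq> 0" "ideal_of D \<subseteq> ideal_of (prin a)"
  shows "prin a dvd D"
proof -
  define J where "J = (\<lambda>y. inverse (to_fract a) * y) ` ideal_of D"
  have "divisorial J"
    unfolding J_def using assms by (intro divisorial_times_image) auto
  moreover have "J \<subseteq> range to_fract"
  proof
    fix z assume "z \<in> J"
    then obtain y where y: "y \<in> ideal_of D" "z = inverse (to_fract a) * y" by (auto simp: J_def)
    then obtain r where "y = to_fract a * to_fract r"
      using assms by (auto simp: ideal_of_prin)
    then show "z \<in> range to_fract" using y assms(1) by (simp flip: mult.assoc)
  qed
  ultimately have "ideal_of (prin a * Divisor J) = (\<lambda>y. to_fract a * y) ` J"
    using assms by (simp add: ideal_of_prin_mult ideal_of_Divisor)
  also have "\<dots> = ideal_of D"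
    using assms by (simp add: J_def image_image flip: mult.assoc)
  finally show ?thesis by (metis dvd_triv_left ideal_of_inject)
qed

lemma discrete_valuation_mult:
  "discrete_valuation v \<Longrightarrow> x \<noteq> 0 \<Longrightarrow> y \<noteq> 0 \<Longrightarrow> v (x * y) = v x + v y"
  by (simp add: discrete_valuation_def)

text \<open>Primality refers to divisibility in the monoid of divisors, whose only unit is
  \<open>1\<close>.\<close>

definition prime_divisor :: "'a::idom divisor \<Rightarrow> bool" where
  "prime_divisor P \<longleftrightarrow> P \<noteq> 1 \<and> (\<forall>D E. P dvd D * E \<longrightarrow> P dvd D \<or> P dvd E)"

text \<open>The choice becomes meaningful for Krull domains, where \<open>ex_divisor_factors\<close>
  gives existence and \<open>divisor_factors_unique\<close> uniqueness.\<close>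

definition divisor_factors :: "'a::idom divisor \<Rightarrow> 'a divisor multiset" where
  "divisor_factors D = (SOME F. (\<forall>P\<in>#F. prime_divisor P) \<and> prod_mset F = D)"

section \<open>Complete integral closedness, cancellation, and containment as divisibility\<close>

context
  assumes krull: "krull_domain TYPE('a::idom)"
begin

lemma krull_valuations:
  obtains V :: "('a fract \<Rightarrow> int) set" where
    "\<And>v. v \<in> V \<Longrightarrow> discrete_valuation v"
    "\<And>x. x \<noteq> 0 \<Longrightarrow> x \<in> range (to_fract :: 'a \<Rightarrow> _) \<longleftrightarrow> (\<forall>v\<in>V. 0 \<le> v x)"
    "\<And>x. x \<noteq> 0 \<Longrightarrow> finite {v \<in> V. v x \<noteq> 0}"
proof -
  obtain V :: "('a fract \<Rightarrow> int) set" where V: "\<forall>v\<in>V. discrete_valuation v"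
      "range (to_fract :: 'a \<Rightarrow> 'a fract) = {x. x = 0 \<or> (\<forall>v\<in>V. 0 \<le> v x)}"
      "\<forall>x. x \<noteq> 0 \<longrightarrow> finite {v \<in> V. v x \<noteq> 0}"
    using krull unfolding krull_domain_def by (elim exE conjE) (rule that; assumption)
  show thesis
  proof (rule that)
    show "x \<in> range (to_fract :: 'a \<Rightarrow> _) \<longleftrightarrow> (\<forall>v\<in>V. 0 \<le> v x)" if "x \<noteq> 0" for x
      unfolding V(2) using that by simp
  qed (use V in auto)
qed

text \<open>Krull domains are completely integrally closed: compare values at an element of \<open>I\<close> of
  minimal value.\<close>

lemma krull_multiplier:
  fixes x :: "'a fract"
  assumes I: "I \<subseteq> range to_fract" "y0 \<in> I" "y0 \<noteq> 0" and x: "\<And>y. y \<in> I \<Longrightarrow> x * y \<in> I"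
  shows "x \<in> range to_fract"
proof (cases "x = 0")
  case False
  obtain V :: "('a fract \<Rightarrow> int) set" where V:
    "\<And>v. v \<in> V \<Longrightarrow> discrete_valuation v"
    "\<And>x. x \<noteq> 0 \<Longrightarrow> x \<in> range (to_fract :: 'a \<Rightarrow> _) \<longleftrightarrow> (\<forall>v\<in>V. 0 \<le> v x)"
    by (rule krull_valuations) blast
  have "0 \<le> v x" if v: "v \<in> V" for v
  proof -
    obtain y where y: "y \<in> I" "y \<noteq> 0"
        and y_min: "\<And>z. z \<in> I \<Longrightarrow> z \<noteq> 0 \<Longrightarrow> nat (v y) \<le> nat (v z)"
      using ex_has_least_nat[of "\<lambda>y. y \<in> I \<and> y \<noteq> 0" y0 "\<lambda>y. nat (v y)"] I by blast
    have "x * y \<in> I" "x * y \<noteq> 0" using x y False by auto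
    moreover from this have "0 \<le> v (x * y)" using V(2) I(1) v by blast
    moreover have "0 \<le> v y" using V(2) I(1) v y by blast
    ultimately have "v y \<le> v (x * y)" using y_min[of "x * y"] by linarith
    then show ?thesis using discrete_valuation_mult[OF V(1)[OF v]] y False by simp
  qed
  then show ?thesis using V(2) False by blast
qed (simp add: zero_in_range_to_fract)

text \<open>For nonzero \<open>a\<close> in \<open>D\<close>, the scaled inverse \<open>I\<close> of
  \<open>D\<close> by \<open>a\<close> is integral and serves as \<open>E\<close>. Complements
  replace inverses of divisors: they turn questions about \<open>D\<close> into questions about
  principal divisors.\<close>

lemma divisor_complement:
  fixes D :: "'a divisor"
  obtains E a where "a \<noteq> 0" "D * E = prin a"
proof -
  obtain a where a: "a \<noteq> 0" "to_fract a \<in> ideal_of D" by (rule ideal_of_obtain_nonzero)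
  define J where "J = ideal_inverse (ideal_of D)"
  define I where "I = (\<lambda>y. to_fract a * y) ` J"
  have J_sub: "module.subspace fract_scale J" unfolding J_def by (rule subspace_ideal_inverse)
  have "1 \<in> J" unfolding J_def ideal_inverse_def using ideal_of_integral[of D] by auto
  then have aI: "to_fract a \<in> I" by (force simp: I_def)
  have I_int: "I \<subseteq> range to_fract"
  proof
    fix z assume "z \<in> I"
    then obtain y where y: "y \<in> J" "z = to_fract a * y" by (auto simp: I_def)
    then have "y * to_fract a \<in> range to_fract" using a unfolding J_def ideal_inverse_def by blast
    then show "z \<in> range to_fract" using y by (simp add: mult.commute)
  qed
  have "v_closure J = J"
    unfolding J_def v_closure_def by (rule ideal_inverse_v_closure[unfolded v_closure_def])
  then have "v_closure I = I" using a by (simp add: I_def v_closure_times_image)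
  then have "divisorial I" using divisorial_integralI[OF _ aI] a I_int by simp
  \<comment> \<open>Up to the factor \<open>a\<close>, this says that \<open>D\<close> times its
    inverse \<open>J\<close> has inverse \<open>A\<close>. An \<open>x\<close> on the left makes
    \<open>to_fract a * x\<close> a multiplier of \<open>J\<close>, hence of its integral copy
    \<open>I\<close>, and \<open>krull_multiplier\<close> applies.\<close>
  have "ideal_inverse (ideal_product I (ideal_of D)) = (\<lambda>y. inverse (to_fract a) * y) ` range to_fract"
    (is "?L = ?R")
  proof
    show "?L \<subseteq> ?R"
    proof
      fix x assume "x \<in> ?L"
      then have x: "x * (to_fract a * y) \<in> J" if "y \<in> J" for y
        using that unfolding ideal_inverse_ideal_product J_def I_def by blast
      have "to_fract a * x \<in> range to_fract"
      proof (rule krull_multiplier[OF I_int aI])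
        fix z assume "z \<in> I"
        then obtain y where y: "y \<in> J" "z = to_fract a * y" by (auto simp: I_def)
        then have "to_fract a * (x * (to_fract a * y)) \<in> I" using x unfolding I_def by blast
        then show "to_fract a * x * z \<in> I" using y by (simp add: mult_ac)
      qed (use a in simp)
      moreover have "x = inverse (to_fract a) * (to_fract a * x)" using a by simp
      ultimately show "x \<in> ?R" by blast
    qed
    show "?R \<subseteq> ?L"
    proof
      fix x assume "x \<in> ?R"
      then obtain r where r: "x = inverse (to_fract a) * to_fract r" by blast
      have "x * z \<in> J" if z: "z \<in> I" for z
      proof -
        obtain y where y: "y \<in> J" "z = to_fract a * y" using z by (auto simp: I_def)
        have "x * z = to_fract r * y" using y r a by simp
        then show ?thesis using fract_scale_mem[OF J_sub y(1) rangeI] by simp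
      qed
      then show "x \<in> ?L" unfolding ideal_inverse_ideal_product J_def by blast
    qed
  qed
  then have "v_product I (ideal_of D) = (\<lambda>y. to_fract a * y) ` range to_fract"
    using a by (simp add: v_product_def v_closure_def ideal_inverse_times_image ideal_inverse_range)
  then have "ideal_of (D * Divisor I) = ideal_of (prin a)"
    using a I_int \<open>divisorial I\<close>
    by (simp add: times_divisor.rep_eq ideal_of_Divisor v_product_commute ideal_of_prin)
  then show thesis using that a by (simp add: ideal_of_inject)
qed

text \<open>Multiplying by a complement of \<open>D\<close> makes the common factor principal, and
  principal factors cancel.\<close>

lemma divisor_mult_cancel [simp]: "D * E = D * F \<longleftrightarrow> E = F" for D :: "'a divisor"
proof
  assume *: "D * E = D * F"
  obtain D' a where D': "a \<noteq> 0" "D * D' = prin a" by (rule divisor_complement)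
  have "prin a * E = prin a * F" using * D'(2) by (metis mult.assoc mult.commute)
  then show "E = F" using D' by (simp add: prin_mult_cancel)
qed simp

lemma divisor_dvd_cancel [simp]: "D * E dvd D * F \<longleftrightarrow> E dvd F" for D :: "'a divisor"
  by (auto simp: dvd_def mult.assoc)

text \<open>To contain is to divide: multiplied by a complement \<open>D'\<close>, the inclusion
  becomes one in a principal ideal, where \<open>prin_dvd_if_subset\<close> applies; then
  \<open>D'\<close> cancels.\<close>

lemma divisor_dvd_iff: "D dvd E \<longleftrightarrow> ideal_of E \<subseteq> ideal_of D" for D :: "'a divisor"
proof
  assume sub: "ideal_of E \<subseteq> ideal_of D"
  obtain D' a where D': "a \<noteq> 0" "D * D' = prin a" by (rule divisor_complement)
  have "D' * D dvd D' * E"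
    using prin_dvd_if_subset[OF D'(1)] ideal_of_mult_mono[OF sub, of D'] D'(2)
    by (simp add: mult.commute)
  then show "D dvd E" by simp
qed (rule dvd_imp_subset)

text \<open>The size of a divisor sums, over the defining valuations, the minimal value on the ideal.\<close>

lemma ex_divisor_size:
  "\<exists>w :: 'a divisor \<Rightarrow> nat. \<forall>D E. ideal_of D \<subset> ideal_of E \<longrightarrow> w E < w D"
proof -
  obtain V :: "('a fract \<Rightarrow> int) set" where V:
    "\<And>v. v \<in> V \<Longrightarrow> discrete_valuation v"
    "\<And>x. x \<noteq> 0 \<Longrightarrow> x \<in> range (to_fract :: 'a \<Rightarrow> _) \<longleftrightarrow> (\<forall>v\<in>V. 0 \<le> v x)"
    "\<And>x. x \<noteq> 0 \<Longrightarrow> finite {v \<in> V. v x \<noteq> 0}"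
    by (rule krull_valuations) blast
  \<comment> \<open>For \<open>v \<in> V\<close> the truncation by \<open>nat\<close> loses nothing,
    since nonzero integral elements have nonnegative values.\<close>
  define m where "m v D = (LEAST n. \<exists>x\<in>ideal_of D. x \<noteq> 0 \<and> nat (v x) = n)"
    for v :: "'a fract \<Rightarrow> int" and D :: "'a divisor"
  have m_le: "m v D \<le> nat (v x)" if "x \<in> ideal_of D" "x \<noteq> 0" for v x D
    unfolding m_def using that by (intro Least_le) blast
  have m_ex: "\<exists>x\<in>ideal_of D. x \<noteq> 0 \<and> nat (v x) = m v D" for v D
  proof -
    have "\<exists>n. \<exists>x\<in>ideal_of D. x \<noteq> 0 \<and> nat (v x) = n"
      using divisorialD(3)[OF divisorial_ideal_of] by blast
    then show ?thesis unfolding m_def by (rule LeastI_ex)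
  qed
  define supp where "supp D = {v \<in> V. m v D \<noteq> 0}" for D
  have fin: "finite (supp D)" for D
  proof -
    obtain x where x: "x \<in> ideal_of D" "x \<noteq> 0" using divisorialD(3)[OF divisorial_ideal_of] by blast
    have "m v D = 0" if "v x = 0" for v using m_le[OF x, of v] that by simp
    then have "supp D \<subseteq> {v \<in> V. v x \<noteq> 0}" by (auto simp: supp_def)
    then show ?thesis using V(3)[OF x(2)] finite_subset by blast
  qed
  have m_mono: "m v E \<le> m v D" if "ideal_of D \<subseteq> ideal_of E" for v D E
    using m_ex[of D v] m_le[of _ E v] that by (metis subsetD)
  \<comment> \<open>The minimal values determine a divisorial ideal. For \<open>z\<close> in
    \<open>E\<close> and \<open>y\<close> in the inverse of \<open>D\<close>, an \<open>x\<close> in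
    \<open>D\<close> of least value gives \<open>v (z * y) \<ge> v (x * y) \<ge> 0\<close>; so
    \<open>z\<close> lies in the double inverse of \<open>D\<close>.\<close>
  have m_eq: "ideal_of E \<subseteq> ideal_of D" if eq: "\<forall>v\<in>V. m v D = m v E" for D E
  proof
    fix z assume z: "z \<in> ideal_of E"
    have "z * y \<in> range to_fract" if y: "y \<in> ideal_inverse (ideal_of D)" for y
    proof (cases "z * y = 0")
      case False
      then have nz: "z \<noteq> 0" "y \<noteq> 0" by auto
      have "0 \<le> v (z * y)" if v: "v \<in> V" for v
      proof -
        obtain x where x: "x \<in> ideal_of D" "x \<noteq> 0" "nat (v x) = m v D" using m_ex by blast
        have "y * x \<in> range to_fract" using x y by (simp add: ideal_inverse_def)
        then have "0 \<le> v (y * x)" using V(2) v nz x by simp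
        moreover have "nat (v x) \<le> nat (v z)" using eq v x m_le[OF z nz(1)] by simp
        moreover have "0 \<le> v x" "0 \<le> v z"
          using V(2) v x z nz ideal_of_integral by blast+
        ultimately show ?thesis
          using discrete_valuation_mult[OF V(1)[OF v]] nz x by simp
      qed
      then show ?thesis using V(2)[OF False] by blast
    next
      case True
      then show ?thesis by (simp only: zero_in_range_to_fract)
    qed
    then have "z \<in> v_closure (ideal_of D)"
      unfolding v_closure_def ideal_inverse_def[of "ideal_inverse _"] by blast
    then show "z \<in> ideal_of D" by (simp add: divisorialD(2)[OF divisorial_ideal_of])
  qed
  have "(\<Sum>v\<in>supp E. m v E) < (\<Sum>v\<in>supp D. m v D)" if "ideal_of D \<subset> ideal_of E" for D E
  proof -
    have sub: "ideal_of D \<subseteq> ideal_of E" using that by blast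
    have "\<not> (\<forall>v\<in>V. m v D = m v E)" using m_eq[of D E] that by auto
    then obtain v where v: "v \<in> V" "m v D \<noteq> m v E" by auto
    with m_mono[OF sub, of v] have "m v E < m v D" by simp
    moreover from this v have "v \<in> supp D" by (simp add: supp_def)
    moreover have "supp E \<subseteq> supp D"
    proof
      fix v assume "v \<in> supp E"
      then show "v \<in> supp D" using m_mono[OF sub, of v] by (simp add: supp_def)
    qed
    then have "(\<Sum>v\<in>supp E. m v E) = (\<Sum>v\<in>supp D. m v E)"
      by (intro sum.mono_neutral_left fin) (auto simp: supp_def)
    ultimately show ?thesis
      using m_mono[OF sub] by (auto intro!: sum_strict_mono_ex1 fin)
  qed
  then show ?thesis by (intro exI[of _ "\<lambda>D. \<Sum>v\<in>supp D. m v D"]) blast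
qed

section \<open>Unique factorization of divisors into prime divisors\<close>

definition divisor_size :: "'a divisor \<Rightarrow> nat" where
  "divisor_size = (SOME w. \<forall>D E. ideal_of D \<subset> ideal_of E \<longrightarrow> w E < w D)"

lemma divisor_size_less:
  assumes "D dvd E" "D \<noteq> E"
  shows "divisor_size D < divisor_size (E :: 'a divisor)"
proof -
  have "ideal_of E \<subset> ideal_of D" using assms by (metis dvd_imp_subset ideal_of_inject psubsetI)
  then show ?thesis
    using someI_ex[OF ex_divisor_size] unfolding divisor_size_def by blast
qed

text \<open>For \<open>d\<close> in \<open>E\<close> outside \<open>P\<close>, the colon ideal
  \<open>Q = P : d\<close> is divisorial, contains \<open>P\<close> and is proper. Irreducibility
  forces \<open>Q = P\<close>, and \<open>P dvd D * E\<close> puts \<open>D\<close> inside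
  \<open>Q\<close>.\<close>

lemma prime_divisor_if_irreducible:
  fixes P :: "'a divisor"
  assumes "P \<noteq> 1" and irred: "\<And>Q. Q dvd P \<Longrightarrow> Q = 1 \<or> Q = P"
  shows "prime_divisor P"
  unfolding prime_divisor_def
proof (intro conjI allI impI)
  fix D E assume dvd: "P dvd D * E"
  show "P dvd D \<or> P dvd E"
  proof (rule disjCI)
    assume "\<not> P dvd E"
    then obtain d where d: "d \<in> ideal_of E" "d \<notin> ideal_of P" by (auto simp: divisor_dvd_iff)
    define Q where "Q = {x \<in> range to_fract. d * x \<in> ideal_of P}"
    have P_sub: "ideal_of P \<subseteq> Q"
    proof
      fix x assume x: "x \<in> ideal_of P"
      obtain r where "d = to_fract r" using d(1) ideal_of_integral by blast
      then show "x \<in> Q" using x ideal_of_integral[of P] ideal_of_scale[OF x] by (auto simp: Q_def)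
    qed
    obtain x where x: "x \<in> ideal_of P" "x \<noteq> 0" using divisorialD(3)[OF divisorial_ideal_of] by blast
    have d0: "d \<noteq> 0"
      using d fract_module.subspace_0[OF divisorialD(1)[OF divisorial_ideal_of[of P]]] by blast
    \<comment> \<open>Closure commutes with scaling by \<open>d\<close>, so \<open>d\<close> carries
      the closure of \<open>Q\<close> into the closed ideal \<open>P\<close>.\<close>
    have "v_closure Q \<subseteq> Q"
    proof
      fix z assume z: "z \<in> v_closure Q"
      have "d * z \<in> v_closure ((\<lambda>y. d * y) ` Q)" using z d0 by (simp add: v_closure_times_image)
      also have "\<dots> \<subseteq> v_closure (ideal_of P)" by (rule v_closure_mono) (auto simp: Q_def)
      finally have "d * z \<in> ideal_of P" by (simp add: divisorialD(2)[OF divisorial_ideal_of])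
      moreover have "z \<in> range to_fract" using z v_closure_integral[of Q] by (auto simp: Q_def)
      ultimately show "z \<in> Q" by (simp add: Q_def)
    qed
    then have "v_closure Q = Q" using subset_v_closure by blast
    moreover have Q_int: "Q \<subseteq> range to_fract" by (auto simp: Q_def)
    ultimately have "divisorial Q" using divisorial_integralI x P_sub by blast
    then have Q: "ideal_of (Divisor Q) = Q" using Q_int by (rule ideal_of_Divisor)
    then have "Divisor Q dvd P" using P_sub by (simp add: divisor_dvd_iff)
    moreover have "1 \<notin> Q" using d by (simp add: Q_def)
    then have "Divisor Q \<noteq> 1" using Q ideal_of_1 one_in_range_to_fract by metis
    ultimately have "Divisor Q = P" using irred by blast
    then have "ideal_of P = Q" using Q by simp
    moreover have "x \<in> Q" if "x \<in> ideal_of D" for x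
    proof -
      have "x * d \<in> ideal_of P" using ideal_of_mult_mem[OF that d(1)] dvd_imp_subset[OF dvd] by blast
      then show ?thesis using that ideal_of_integral[of D] by (auto simp: Q_def mult.commute)
    qed
    ultimately show "P dvd D" by (auto simp: divisor_dvd_iff)
  qed
qed fact

text \<open>A divisor of \<open>D\<close> other than \<open>1\<close> of least
  \<open>divisor_size\<close> is irreducible, hence prime.\<close>

lemma ex_prime_divisor_dvd:
  fixes D :: "'a divisor"
  assumes "D \<noteq> 1"
  obtains P where "prime_divisor P" "P dvd D"
proof -
  obtain P where P: "P dvd D" "P \<noteq> 1"
      and P_min: "\<And>Q. Q dvd D \<Longrightarrow> Q \<noteq> 1 \<Longrightarrow> divisor_size P \<le> divisor_size Q"
    using ex_has_least_nat[of "\<lambda>Q. Q dvd D \<and> Q \<noteq> 1" D divisor_size] assms by auto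
  have "prime_divisor P"
  proof (rule prime_divisor_if_irreducible[OF P(2)])
    fix Q assume Q: "Q dvd P"
    then have "Q dvd D" using P(1) by (rule dvd_trans)
    then show "Q = 1 \<or> Q = P" using P_min[of Q] divisor_size_less[OF Q] by linarith
  qed
  then show thesis using that P by blast
qed

lemma ex_divisor_factors: "\<exists>F. (\<forall>P\<in>#F. prime_divisor P) \<and> prod_mset F = (D :: 'a divisor)"
proof (induction "divisor_size D" arbitrary: D rule: less_induct)
  case less
  show ?case
  proof (cases "D = 1")
    case True then show ?thesis by (intro exI[of _ "{#}"]) simp
  next
    case False
    obtain P where P: "prime_divisor P" "P dvd D" by (rule ex_prime_divisor_dvd[OF False])
    then obtain E where E: "D = P * E" by (auto elim: dvdE)
    \<comment> \<open>Cancellation guarantees that splitting off \<open>P\<close> leaves a proper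
      divisor, so that the size drops.\<close>
    have "E \<noteq> D"
    proof
      assume "E = D"
      then have "E * P = E * 1" using E by (simp add: mult.commute)
      then have "P = 1" by (simp only: divisor_mult_cancel)
      then show False using P(1) by (simp add: prime_divisor_def)
    qed
    then have "divisor_size E < divisor_size D" using E by (intro divisor_size_less) auto
    then obtain F where "\<forall>P\<in>#F. prime_divisor P" "prod_mset F = E" using less by blast
    then show ?thesis using P E by (intro exI[of _ "add_mset P F"]) auto
  qed
qed

text \<open>Write \<open>Q = P * K\<close>. As \<open>Q\<close> is prime it divides \<open>P\<close>
  or \<open>K\<close>; the latter would cancel to \<open>P dvd 1\<close>.\<close>

lemma prime_divisor_dvd_prime:
  fixes P Q :: "'a divisor"
  assumes "prime_divisor P" "prime_divisor Q" "P dvd Q"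
  shows "P = Q"
proof -
  obtain K where K: "Q = P * K" using assms by (auto elim: dvdE)
  then have "Q dvd P \<or> Q dvd K" using assms(2) unfolding prime_divisor_def by (metis dvd_refl)
  moreover have "\<not> Q dvd K"
  proof
    assume "Q dvd K"
    then have "K * P dvd K * 1" using K by (simp add: mult.commute)
    then have "P dvd 1" by (simp only: divisor_dvd_cancel)
    then show False using assms by (simp add: prime_divisor_def)
  qed
  ultimately show ?thesis using assms divisor_dvd_antisym by blast
qed

lemma prime_divisor_dvd_prod_mset:
  "prime_divisor P \<Longrightarrow> P dvd prod_mset F \<Longrightarrow> \<exists>Q\<in>#F. P dvd (Q :: 'a divisor)"
  by (induction F) (auto simp: prime_divisor_def)

text \<open>Each prime of \<open>F\<close> equals some prime of \<open>G\<close> and can be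
  cancelled. Used in both directions, this yields uniqueness of the factorization.\<close>

lemma prime_divisors_dvd_imp_subset:
  assumes "\<forall>P\<in>#F. prime_divisor P" "\<forall>P\<in>#G. prime_divisor P" "prod_mset F dvd (prod_mset G :: 'a divisor)"
  shows "F \<subseteq># G"
  using assms
proof (induction F arbitrary: G)
  case (add P F)
  have "P dvd prod_mset G" using add.prems(3) by (auto intro: dvd_mult_left)
  then obtain Q where "Q \<in># G" "P dvd Q"
    using prime_divisor_dvd_prod_mset add.prems(1) by fastforce
  then have "P \<in># G" using prime_divisor_dvd_prime[of P Q] add.prems by auto
  then obtain G' where G': "G = add_mset P G'" by (meson multi_member_split)
  then have "F \<subseteq># G'" using add by auto
  then show ?case using G' by simp
qed simp

lemma divisor_factors:
  "P \<in># divisor_factors D \<Longrightarrow> prime_divisor P"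
  "prod_mset (divisor_factors D) = (D :: 'a divisor)"
  using someI_ex[OF ex_divisor_factors[of D]] by (auto simp: divisor_factors_def)

lemma divisor_factors_unique:
  "\<forall>P\<in>#F. prime_divisor P \<Longrightarrow> divisor_factors (prod_mset F :: 'a divisor) = F"
  using divisor_factors prime_divisors_dvd_imp_subset by (metis dvd_refl subset_mset.antisym)

lemma divisor_factors_mult [simp]:
  "divisor_factors (D * E) = divisor_factors D + divisor_factors (E :: 'a divisor)"
  using divisor_factors_unique[of "divisor_factors D + divisor_factors E"] divisor_factors by auto

lemma divisor_factors_prime [simp]:
  "prime_divisor P \<Longrightarrow> divisor_factors P = {#P :: 'a divisor#}"
  using divisor_factors_unique[of "{#P#}"] by simp

lemma divisor_factors_eq_empty_iff [simp]: "divisor_factors D = {#} \<longleftrightarrow> D = (1 :: 'a divisor)"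
  using divisor_factors(2)[of D] divisor_factors_unique[of "{#}"] by auto

end

section \<open>Divisor classes\<close>

definition principal_divisor :: "'a::idom divisor \<Rightarrow> bool" where
  "principal_divisor D \<longleftrightarrow> (\<exists>a. a \<noteq> 0 \<and> D = prin a)"

lemma principal_divisor_prin: "a \<noteq> 0 \<Longrightarrow> principal_divisor (prin a)"
  by (auto simp: principal_divisor_def)

lemma principal_divisor_1: "principal_divisor 1"
  using principal_divisor_prin[of 1] by simp

lemma principal_divisor_mult:
  "principal_divisor D \<Longrightarrow> principal_divisor E \<Longrightarrow> principal_divisor (D * E)"
  by (metis no_zero_divisors principal_divisor_def prin_mult)

text \<open>If \<open>prin a\<close> divides \<open>prin b\<close> then \<open>b = a * c\<close>,
  and \<open>E = prin c\<close>. This supplies the group arithmetic of classes without leaving the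
  integral divisors.\<close>

lemma principal_divisor_cancel:
  assumes "principal_divisor D"
  shows "principal_divisor (D * E) \<longleftrightarrow> principal_divisor E"
proof
  assume "principal_divisor (D * E)"
  then obtain b where b: "b \<noteq> 0" "D * E = prin b" by (auto simp: principal_divisor_def)
  obtain a where a: "a \<noteq> 0" "D = prin a" using assms by (auto simp: principal_divisor_def)
  have "prin a dvd prin b" using a b by (metis dvd_triv_left)
  then obtain c where c: "b = a * c" using a b by (auto simp: prin_dvd_iff elim: dvdE)
  then have "prin a * E = prin a * prin c" using a b by (simp add: prin_mult)
  then have "E = prin c" using a by (simp add: prin_mult_cancel)
  then show "principal_divisor E" using b c by (auto simp: principal_divisor_def)
qed (use assms principal_divisor_mult in blast)

text \<open>This is the coset of \<open>ideal_of D\<close> modulo the principal fractional ideals,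
  as a set of fractional ideals, so that it can be compared with elements of
  \<open>divisor_class_group\<close>.\<close>

definition divisor_class :: "'a::idom divisor \<Rightarrow> 'a fract set set" where
  "divisor_class D = {(\<lambda>y. x * y) ` ideal_of D | x. x \<noteq> 0}"

text \<open>Multiplication by a principal ideal is scaling, so cosets are orbits under scaling; a
  common denominator \<open>d\<close> moves any divisorial ideal to an integral one in the same
  orbit.\<close>

lemma carrier_divisor_class_group: "carrier divisor_class_group = range divisor_class"
proof -
  let ?H = "{principal_ideal x | x. x \<noteq> (0 :: 'a fract)}"
  have coset: "?H #>\<^bsub>divisor_group\<^esub> I = {(\<lambda>y. x * y) ` I | x. x \<noteq> 0}" if "divisorial I" for I
  proof -
    have "?H #>\<^bsub>divisor_group\<^esub> I = {v_product (principal_ideal x) I | x. x \<noteq> 0}"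
      unfolding r_coset_def divisor_group_def v_product_def by auto
    also have "\<dots> = {(\<lambda>y. x * y) ` I | x. x \<noteq> 0}"
      using that by (metis (no_types, lifting) v_product_principal_ideal)
    finally show ?thesis .
  qed
  have "carrier divisor_class_group = {?H #>\<^bsub>divisor_group\<^esub> I | I. divisorial I}"
    unfolding divisor_class_group_def FactGroup_def RCOSETS_def by (auto simp: divisor_group_def)
  also have "\<dots> = {{(\<lambda>y. x * y) ` I | x. x \<noteq> 0} | I. divisorial I}"
    by (metis (no_types, lifting) coset)
  also have "\<dots> = range divisor_class"
  proof (intro subset_antisym subsetI)
    fix C assume "C \<in> {{(\<lambda>y. x * y) ` I | x. x \<noteq> 0} | I. divisorial I}"
    then obtain I where I: "divisorial I" "C = {(\<lambda>y. x * y) ` I | x. x \<noteq> 0}" by blast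
    obtain d where d: "d \<noteq> 0" "\<forall>x\<in>I. to_fract d * x \<in> range to_fract"
      using divisorialD(4)[OF I(1)] by blast
    define J where "J = (\<lambda>y. to_fract d * y) ` I"
    have "divisorial J" unfolding J_def using d I by (intro divisorial_times_image) auto
    moreover have "J \<subseteq> range to_fract" using d by (auto simp: J_def)
    ultimately have J: "ideal_of (Divisor J) = J" by (rule ideal_of_Divisor)
    have "C = divisor_class (Divisor J)"
      unfolding I(2) divisor_class_def J
    proof (intro subset_antisym subsetI)
      fix K assume "K \<in> {(\<lambda>y. x * y) ` I | x. x \<noteq> 0}"
      then obtain x where x: "x \<noteq> 0" "K = (\<lambda>y. x * y) ` I" by blast
      then have "K = (\<lambda>y. x / to_fract d * y) ` J" "x / to_fract d \<noteq> 0"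
        using d by (simp_all add: J_def image_image)
      then show "K \<in> {(\<lambda>y. x * y) ` J | x. x \<noteq> 0}" by blast
    next
      fix K assume "K \<in> {(\<lambda>y. x * y) ` J | x. x \<noteq> 0}"
      then obtain x where x: "x \<noteq> 0" "K = (\<lambda>y. x * y) ` J" by blast
      then have "K = (\<lambda>y. x * to_fract d * y) ` I" "x * to_fract d \<noteq> 0"
        using d by (simp_all add: J_def image_image mult.assoc)
      then show "K \<in> {(\<lambda>y. x * y) ` I | x. x \<noteq> 0}" by blast
    qed
    then show "C \<in> range divisor_class" by blast
  next
    fix C :: "'a fract set set" assume "C \<in> range divisor_class"
    then show "C \<in> {{(\<lambda>y. x * y) ` I | x. x \<noteq> 0} | I. divisorial I}"
      unfolding divisor_class_def using divisorial_ideal_of by blast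
  qed
  finally show ?thesis .
qed

text \<open>Writing the scaling factor as \<open>a / b\<close> and clearing denominators expresses
  equivalence inside the monoid of integral divisors.\<close>

lemma ideal_of_mem_divisor_class_iff:
  "ideal_of E \<in> divisor_class D \<longleftrightarrow> (\<exists>a b. a \<noteq> 0 \<and> b \<noteq> 0 \<and> prin a * E = prin b * D)"
proof
  assume "ideal_of E \<in> divisor_class D"
  then obtain x where x: "x \<noteq> 0" "ideal_of E = (\<lambda>y. x * y) ` ideal_of D"
    by (auto simp: divisor_class_def)
  obtain a b where ab: "x = to_fract a / to_fract b" "b \<noteq> 0"
    by (metis Fract_conv_to_fract Fract_cases)
  have "a \<noteq> 0" using ab x by auto
  moreover have "prin b * E = prin a * D"
    using \<open>a \<noteq> 0\<close> ab
    by (simp add: x ideal_of_prin_mult image_image flip: ideal_of_inject)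
  ultimately show "\<exists>a b. a \<noteq> 0 \<and> b \<noteq> 0 \<and> prin a * E = prin b * D" using ab by blast
next
  assume "\<exists>a b. a \<noteq> 0 \<and> b \<noteq> 0 \<and> prin a * E = prin b * D"
  then obtain a b where ab: "a \<noteq> 0" "b \<noteq> 0" "prin a * E = prin b * D" by blast
  then have eq: "(\<lambda>y. to_fract a * y) ` ideal_of E = (\<lambda>y. to_fract b * y) ` ideal_of D"
    by (simp flip: ideal_of_prin_mult)
  have "ideal_of E = (\<lambda>y. inverse (to_fract a) * y) ` ((\<lambda>y. to_fract a * y) ` ideal_of E)"
    using ab by (simp add: image_image flip: mult.assoc)
  also have "\<dots> = (\<lambda>y. inverse (to_fract a) * to_fract b * y) ` ideal_of D"
    unfolding eq by (simp add: image_image mult.assoc)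
  finally show "ideal_of E \<in> divisor_class D"
    unfolding divisor_class_def using ab
    by (auto intro!: exI[of _ "inverse (to_fract a) * to_fract b"])
qed

lemma ideal_of_mem_divisor_class: "ideal_of D \<in> divisor_class D"
  unfolding ideal_of_mem_divisor_class_iff by (intro exI[of _ 1]) simp

lemma principal_divisor_mult_transfer:
  assumes "ideal_of E \<in> divisor_class D" "principal_divisor (D * F)"
  shows "principal_divisor (E * F)"
proof -
  obtain a b where ab: "a \<noteq> 0" "b \<noteq> 0" "prin a * E = prin b * D"
    using assms by (auto simp: ideal_of_mem_divisor_class_iff)
  have "principal_divisor (prin b * (D * F))"
    using assms ab principal_divisor_mult principal_divisor_prin by blast
  also have "prin b * (D * F) = prin a * (E * F)" using ab by (metis mult.assoc)
  finally show ?thesis using ab by (simp add: principal_divisor_cancel principal_divisor_prin)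
qed

text \<open>\<open>D\<close> and \<open>E\<close> have the common inverse class of \<open>F\<close>:
  if \<open>D * F = prin a\<close> and \<open>E * F = prin b\<close>, then
  \<open>prin b * D = prin a * E\<close>.\<close>

lemma divisor_class_eqI:
  assumes "principal_divisor (D * F)" "principal_divisor (E * F)"
  shows "divisor_class D = divisor_class E"
proof -
  have sub: "divisor_class D \<subseteq> divisor_class E"
    if pr: "principal_divisor (D * F)" "principal_divisor (E * F)" for D E F :: "'a divisor"
  proof -
    obtain a b where ab: "a \<noteq> 0" "b \<noteq> 0" "D * F = prin a" "E * F = prin b"
      using pr by (auto simp: principal_divisor_def)
    have "prin b * D = prin a * E" unfolding ab(3,4)[symmetric] by (simp add: mult_ac)
    then have "ideal_of D \<in> divisor_class E" using ab by (auto simp: ideal_of_mem_divisor_class_iff)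
    then obtain x where x: "x \<noteq> 0" "ideal_of D = (\<lambda>y. x * y) ` ideal_of E"
      by (auto simp: divisor_class_def)
    show ?thesis
    proof
      fix I assume "I \<in> divisor_class D"
      then obtain z where "z \<noteq> 0" "I = (\<lambda>y. z * y) ` ideal_of D" by (auto simp: divisor_class_def)
      then have "z * x \<noteq> 0" "I = (\<lambda>y. z * x * y) ` ideal_of E"
        using x by (auto simp: image_image mult.assoc)
      then show "I \<in> divisor_class E" unfolding divisor_class_def by blast
    qed
  qed
  show ?thesis using sub[OF assms] sub[OF assms(2,1)] by blast
qed

lemma divisor_class_eqD:
  "divisor_class D = divisor_class E \<Longrightarrow> principal_divisor (D * F) \<Longrightarrow> principal_divisor (E * F)"
  using principal_divisor_mult_transfer ideal_of_mem_divisor_class by metis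

lemma divisor_class_eq_1_iff: "divisor_class D = divisor_class 1 \<longleftrightarrow> principal_divisor D"
  using divisor_class_eqD[of 1 D 1] divisor_class_eqI[of D 1 1] principal_divisor_1 by auto

text \<open>The finiteness conjunct excludes infinite class groups, for which \<open>card\<close> is
  \<open>0\<close>.\<close>

abbreviation class_group_order_le_2 :: "'a::idom itself \<Rightarrow> bool" where
  "class_group_order_le_2 _ \<equiv> finite (range (divisor_class :: 'a divisor \<Rightarrow> _)) \<and>
     card (range (divisor_class :: 'a divisor \<Rightarrow> _)) \<le> 2"

lemma divisor_inverse_class:
  fixes D :: "'a::idom divisor"
  assumes "krull_domain TYPE('a)"
  obtains E where "principal_divisor (D * E)"
  using divisor_complement[OF assms, of D] by (metis principal_divisor_def)

text \<open>The class of \<open>D\<close> and the inverse class of \<open>E\<close> both differ from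
  the trivial one, hence coincide.\<close>

lemma principal_divisor_mult_if_order_le_2:
  fixes D E :: "'a::idom divisor"
  assumes krull: "krull_domain TYPE('a)" and small: "class_group_order_le_2 TYPE('a)"
    and "\<not> principal_divisor D" "\<not> principal_divisor E"
  shows "principal_divisor (D * E)"
proof -
  obtain E' where E': "principal_divisor (E * E')" by (rule divisor_inverse_class[OF krull])
  have "\<not> principal_divisor E'"
    using assms(4) E' by (metis mult.commute principal_divisor_cancel)
  then have "divisor_class D \<noteq> divisor_class 1" "divisor_class E' \<noteq> divisor_class 1"
    using assms(3) by (simp_all add: divisor_class_eq_1_iff)
  moreover have "card {divisor_class 1, divisor_class D, divisor_class E'} \<le> 2"
    using small by (meson card_mono dual_order.trans empty_subsetI insert_subset rangeI)
  ultimately have "divisor_class E' = divisor_class D"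
    by (auto simp: card_insert_if split: if_splits)
  then show ?thesis using divisor_class_eqD[of E' D E] E' by (simp add: mult.commute)
qed

text \<open>Otherwise every class would be trivial or inverse to that of \<open>D\<close>, which
  leaves at most two.\<close>

lemma ex_nonprincipal_if_not_order_le_2:
  fixes D :: "'a::idom divisor"
  assumes krull: "krull_domain TYPE('a)" and large: "\<not> class_group_order_le_2 TYPE('a)"
  obtains E where "\<not> principal_divisor E" "\<not> principal_divisor (D * E)"
proof (rule ccontr)
  assume "\<not> thesis"
  then have *: "principal_divisor E \<or> principal_divisor (D * E)" for E using that by blast
  obtain D' where D': "principal_divisor (D * D')" by (rule divisor_inverse_class[OF krull])
  have "divisor_class E \<in> {divisor_class 1, divisor_class D'}" for E
    using *[of E] D' divisor_class_eqI[of E D D'] by (auto simp: divisor_class_eq_1_iff mult.commute)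
  then have "range divisor_class \<subseteq> {divisor_class 1, divisor_class D'}" by blast
  then have "finite (range (divisor_class :: 'a divisor \<Rightarrow> _))"
      "card (range (divisor_class :: 'a divisor \<Rightarrow> _)) \<le> card {divisor_class 1, divisor_class D'}"
    by (auto intro: finite_subset card_mono)
  moreover have "card {divisor_class 1, divisor_class D'} \<le> 2" by (simp add: card_insert_if)
  ultimately show False using large by linarith
qed

text \<open>A prime ideal in the class of \<open>D\<close> is a scaled copy of
  \<open>ideal_of D\<close>, hence divisorial; its primality on elements passes to divisors because
  containment is divisibility.\<close>

lemma ex_prime_divisor_in_class:
  assumes krull: "krull_domain TYPE('a::idom)" and "every_class_has_height_one_prime TYPE('a)"
  obtains P where "prime_divisor P" "divisor_class P = divisor_class (D :: 'a divisor)"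
proof -
  have "divisor_class D \<in> carrier divisor_class_group"
    unfolding carrier_divisor_class_group by blast
  then obtain P0 :: "'a set" where P0: "prime_ideal P0" "to_fract ` P0 \<in> divisor_class D"
    using assms unfolding every_class_has_height_one_prime_def by blast
  then obtain x where "x \<noteq> 0" "to_fract ` P0 = (\<lambda>y. x * y) ` ideal_of D"
    by (auto simp: divisor_class_def)
  then have "divisorial (to_fract ` P0)" using divisorial_times_image divisorial_ideal_of by metis
  then have P: "ideal_of (Divisor (to_fract ` P0)) = to_fract ` P0"
    by (intro ideal_of_Divisor) auto
  have "prime_divisor (Divisor (to_fract ` P0))"
    unfolding prime_divisor_def
  proof (intro conjI allI impI)
    show "Divisor (to_fract ` P0) \<noteq> 1"
    proof
      assume "Divisor (to_fract ` P0) = 1"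
      then have "range to_fract = to_fract ` P0" using P ideal_of_1 by metis
      moreover have "inj (to_fract :: 'a \<Rightarrow> _)" by (simp add: inj_on_def)
      ultimately have "P0 = UNIV" using inj_image_eq_iff by metis
      then show False using P0 by (simp add: prime_ideal_def)
    qed
    fix D E assume "Divisor (to_fract ` P0) dvd D * E"
    from dvd_imp_subset[OF this] have sub: "ideal_of (D * E) \<subseteq> to_fract ` P0" unfolding P .
    have "ideal_of D \<subseteq> to_fract ` P0 \<or> ideal_of E \<subseteq> to_fract ` P0"
    proof (rule ccontr)
      assume "\<not> ?thesis"
      then obtain x y where xy: "x \<in> ideal_of D" "x \<notin> to_fract ` P0"
          "y \<in> ideal_of E" "y \<notin> to_fract ` P0" by blast
      then obtain d e where de: "x = to_fract d" "y = to_fract e"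
        using ideal_of_integral by blast
      then have "to_fract (d * e) \<in> to_fract ` P0"
        using ideal_of_mult_mem[OF xy(1,3)] sub by auto
      then have "d * e \<in> P0" by (simp only: image_iff to_fract_eq_iff) simp
      then show False using P0 xy de by (auto simp: prime_ideal_def)
    qed
    then show "Divisor (to_fract ` P0) dvd D \<or> Divisor (to_fract ` P0) dvd E"
      by (simp add: divisor_dvd_iff[OF krull] P)
  qed
  moreover obtain F where F: "principal_divisor (D * F)" by (rule divisor_inverse_class[OF krull])
  have "divisor_class (Divisor (to_fract ` P0)) = divisor_class D"
    using principal_divisor_mult_transfer[OF _ F] F P P0(2) by (intro divisor_class_eqI[of _ F]) metis+
  ultimately show thesis using that by blast
qed


section \<open>Atoms\<close>

lemma dvd_unit_mult_cancel:
  fixes d u x :: "'a::comm_semiring_1"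
  assumes "d dvd u * x" "u dvd 1"
  shows "d dvd x"
proof -
  obtain v where v: "1 = u * v" using assms(2) by (auto elim: dvdE)
  have "d dvd u * x * v" using assms(1) by simp
  also have "u * x * v = x" using v by (metis mult.assoc mult.commute mult_1)
  finally show ?thesis .
qed

context
  assumes krull: "krull_domain TYPE('a::idom)"
begin

lemma divisor_factors_prin_mult:
  "a \<noteq> 0 \<Longrightarrow> b \<noteq> 0 \<Longrightarrow>
    divisor_factors (prin (a * b)) = divisor_factors (prin a) + divisor_factors (prin (b :: 'a))"
  by (simp add: prin_mult divisor_factors_mult[OF krull])

lemma divisor_factors_prin_empty_iff:
  "a \<noteq> 0 \<Longrightarrow> divisor_factors (prin a) = {#} \<longleftrightarrow> (a :: 'a) dvd 1"
  by (simp add: divisor_factors_eq_empty_iff[OF krull] prin_eq_1_iff)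

section \<open>Atoms in terms of their prime divisors\<close>

lemma irreducible_prin_subset:
  assumes a: "irreducible (a :: 'a)" and N: "N \<subseteq># divisor_factors (prin a)"
    and pr: "principal_divisor (prod_mset N)"
  shows "N = {#} \<or> N = divisor_factors (prin a)"
proof -
  obtain b where b: "b \<noteq> 0" "prod_mset N = prin b" using pr by (auto simp: principal_divisor_def)
  have a0: "a \<noteq> 0" using a by auto
  have N_eq: "N = divisor_factors (prin b)"
    using divisor_factors_unique[OF krull, of N] divisor_factors(1)[OF krull] N b(2)
    by (metis mset_subset_eqD)
  have "prod_mset N dvd prod_mset (divisor_factors (prin a))"
    using N by (rule prod_mset_subset_imp_dvd)
  then have "b dvd a" using b a0 by (simp add: divisor_factors(2)[OF krull] prin_dvd_iff)
  then obtain c where c: "a = b * c" by (auto elim: dvdE)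
  then have c0: "c \<noteq> 0" using a0 by auto
  have "b dvd 1 \<or> c dvd 1" using a c by (auto dest: irreducibleD)
  then show ?thesis
    using divisor_factors_prin_empty_iff[of b] divisor_factors_prin_empty_iff[of c]
      divisor_factors_prin_mult[of b c] b c c0 N_eq by auto
qed

text \<open>Converse of \<open>irreducible_prin_subset\<close>: the prime divisors of a factor
  \<open>b\<close> form a principal part of those of \<open>a\<close>.\<close>

lemma irreducible_prinI:
  assumes "(a :: 'a) \<noteq> 0" "divisor_factors (prin a) \<noteq> {#}"
    and N: "\<And>N. N \<subseteq># divisor_factors (prin a) \<Longrightarrow> principal_divisor (prod_mset N) \<Longrightarrow>
      N = {#} \<or> N = divisor_factors (prin a)"
  shows "irreducible a"
proof (rule irreducibleI)
  show "a \<noteq> 0" "\<not> a dvd 1" using assms divisor_factors_prin_empty_iff by auto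
  fix b c assume a: "a = b * c"
  then have bc: "b \<noteq> 0" "c \<noteq> 0" using assms by auto
  then have split: "divisor_factors (prin a) = divisor_factors (prin b) + divisor_factors (prin c)"
    unfolding a by (rule divisor_factors_prin_mult)
  have "divisor_factors (prin b) = {#} \<or> divisor_factors (prin b) = divisor_factors (prin a)"
    using bc split by (intro N) (auto simp: divisor_factors(2)[OF krull] principal_divisor_prin)
  then show "b dvd 1 \<or> c dvd 1"
    using split bc by (auto simp: divisor_factors_prin_empty_iff)
qed

text \<open>Splitting at most three primes into two nonempty parts leaves a part with a single
  prime, which would then be principal.\<close>

lemma irreducible_if_few_factors:
  assumes a: "(a :: 'a) \<noteq> 0" "divisor_factors (prin a) \<noteq> {#}"
    and size: "size (divisor_factors (prin a)) \<le> 3"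
    and nonpr: "\<And>P. P \<in># divisor_factors (prin a) \<Longrightarrow> \<not> principal_divisor P"
  shows "irreducible a"
proof (rule irreducibleI)
  show "a \<noteq> 0" "\<not> a dvd 1" using a divisor_factors_prin_empty_iff by auto
  fix b c assume bc: "a = b * c"
  then have bc0: "b \<noteq> 0" "c \<noteq> 0" using a by auto
  then have split: "divisor_factors (prin a) = divisor_factors (prin b) + divisor_factors (prin c)"
    unfolding bc by (rule divisor_factors_prin_mult)
  have not1: "size (divisor_factors (prin x)) \<noteq> 1"
    if x: "x \<noteq> 0" "divisor_factors (prin x) \<subseteq># divisor_factors (prin a)" for x
  proof
    assume "size (divisor_factors (prin x)) = 1"
    then obtain P where P: "divisor_factors (prin x) = {#P#}" using size_1_singleton_mset by blast
    then have "prin x = P" using divisor_factors(2)[OF krull, of "prin x"] by simp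
    then show False using x P nonpr[of P] principal_divisor_prin by auto
  qed
  have "size (divisor_factors (prin b)) = 0 \<or> size (divisor_factors (prin c)) = 0"
  proof -
    have "size (divisor_factors (prin b)) \<noteq> 1" "size (divisor_factors (prin c)) \<noteq> 1"
      using not1 bc0 by (simp_all add: split)
    then show ?thesis using size unfolding split size_union by linarith
  qed
  then show "b dvd 1 \<or> c dvd 1" using bc0 by (auto simp: divisor_factors_prin_empty_iff)
qed

text \<open>Contrapositively, an atom that is not prime has at least two prime divisors, which is
  what \<open>bad_atom_if_several_factors\<close> requires.\<close>

lemma prime_elem_if_single_factor:
  assumes a: "(a :: 'a) \<noteq> 0" and size: "size (divisor_factors (prin a)) = 1"
  shows "prime_elem a"
proof (rule prime_elemI)
  obtain P where P: "divisor_factors (prin a) = {#P#}" using size size_1_singleton_mset by blast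
  then have "prin a = P" using divisor_factors(2)[OF krull, of "prin a"] by simp
  moreover have "prime_divisor P" using P divisor_factors(1)[OF krull, of P "prin a"] by simp
  ultimately have prime: "prime_divisor (prin a)" by simp
  show "a \<noteq> 0" by fact
  show "\<not> a dvd 1" using prime a by (simp add: prime_divisor_def prin_eq_1_iff)
  fix b c assume "a dvd b * c"
  show "a dvd b \<or> a dvd c"
  proof (cases "b = 0 \<or> c = 0")
    case False
    then have "prin a dvd prin b * prin c"
      using \<open>a dvd b * c\<close> a by (metis no_zero_divisors prin_dvd_iff prin_mult)
    then show ?thesis using prime False a unfolding prime_divisor_def by (metis prin_dvd_iff)
  qed auto
qed

text \<open>The number of prime divisors is additive and is positive on nonunits, so it drops in
  every proper factorization.\<close>

lemma krull_atomic: "atomic_domain TYPE('a)"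
proof -
  have "\<exists>F. factorization_of F x" if "x \<noteq> 0" "\<not> x dvd 1" for x :: 'a
    using that
  proof (induction "size (divisor_factors (prin x))" arbitrary: x rule: less_induct)
    case less
    show ?case
    proof (cases "irreducible x")
      case True
      then show ?thesis by (intro exI[of _ "{#x#}"]) (simp add: factorization_of_def)
    next
      case False
      then obtain b c where bc: "x = b * c" "\<not> b dvd 1" "\<not> c dvd 1"
        using less.prems unfolding irreducible_def by blast
      then have bc0: "b \<noteq> 0" "c \<noteq> 0" using less.prems by auto
      then have split: "divisor_factors (prin x) = divisor_factors (prin b) + divisor_factors (prin c)"
        unfolding bc by (intro divisor_factors_prin_mult)
      have ne: "divisor_factors (prin b) \<noteq> {#}" "divisor_factors (prin c) \<noteq> {#}"
        using bc0 bc by (simp_all add: divisor_factors_prin_empty_iff)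
      obtain F where "factorization_of F b"
        using less.hyps[of b] split ne bc bc0 by (auto simp: nonempty_has_size)
      moreover obtain G where "factorization_of G c"
        using less.hyps[of c] split ne bc bc0 by (auto simp: nonempty_has_size)
      ultimately show ?thesis using bc
        by (intro exI[of _ "F + G"]) (auto simp: factorization_of_def)
    qed
  qed
  then show ?thesis by (simp add: atomic_domain_def)
qed

subsection \<open>Small class groups\<close>

text \<open>Principal prime divisors are atoms, and two nonprincipal ones make an atom; so with these
  weights every atom weighs 2.\<close>

lemma half_factorial_if_order_le_2:
  assumes small: "class_group_order_le_2 TYPE('a)"
  shows "half_factorial_domain TYPE('a)"
proof -
  define weight :: "'a \<Rightarrow> nat" where
    "weight x = (\<Sum>P\<in>#divisor_factors (prin x). if principal_divisor P then 2 else 1)" for x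
  have weight_atom: "weight a = 2" if a: "irreducible a" for a
  proof -
    let ?F = "divisor_factors (prin a)"
    have pr: "principal_divisor (prod_mset ?F)"
      using a by (auto simp: divisor_factors(2)[OF krull] intro: principal_divisor_prin)
    have ne: "?F \<noteq> {#}" using a divisor_factors_prin_empty_iff[of a] by (auto simp: irreducible_def)
    show ?thesis
    proof (cases "\<exists>P\<in>#?F. principal_divisor P")
      case True
      then obtain P where P: "P \<in># ?F" "principal_divisor P" by blast
      then have "?F = {#P#}" using irreducible_prin_subset[OF a, of "{#P#}"] by auto
      then show ?thesis using P by (simp add: weight_def)
    next
      case False
      obtain P F where P: "?F = add_mset P F" using ne by (cases ?F) auto
      \<comment> \<open>With \<open>F\<close> empty, \<open>P\<close> alone would have the principal
        product \<open>prin a\<close>.\<close>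
      have "F \<noteq> {#}" using P pr False by auto
      then obtain Q G where Q: "F = add_mset Q G" by (cases F) auto
      have "principal_divisor (P * Q)"
        using P Q False by (intro principal_divisor_mult_if_order_le_2[OF krull small]) auto
      then have "?F = {#P, Q#}" using irreducible_prin_subset[OF a, of "{#P, Q#}"] P Q by auto
      then show ?thesis using False by (simp add: weight_def)
    qed
  qed
  have weight_mult: "weight (a * x) = 2 + weight x" if "irreducible a" "x \<noteq> 0" for a x
  proof -
    have "a \<noteq> 0" using that by auto
    then have "weight (a * x) = weight a + weight x"
      using that by (simp add: weight_def divisor_factors_prin_mult)
    then show ?thesis using weight_atom that by simp
  qed
  have weight_1: "weight 1 = 0" using divisor_factors_prin_empty_iff[of 1] by (simp add: weight_def)
  \<comment> \<open>The weight depends only on the product, so it recovers the number of atoms in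
    any factorization.\<close>
  have weight_prod: "(\<forall>a\<in>#F. irreducible a) \<Longrightarrow>
      prod_mset F \<noteq> 0 \<and> weight (prod_mset F) = 2 * size F" for F
    by (induction F) (auto simp: weight_1 weight_mult)
  show ?thesis
    unfolding half_factorial_domain_def factorization_of_def using krull_atomic weight_prod
    by (metis mult_left_cancel zero_neq_numeral)
qed

subsection \<open>Large class groups\<close>

text \<open>The second atom \<open>b\<close> is the cofactor of \<open>a\<close> in the product of
  the \<open>c P\<close>. The partners \<open>q P\<close> and atoms \<open>c P\<close> are
  parameters, so that a prescribed atom with two prime divisors can be made one of the
  \<open>c P\<close>.\<close>

lemma ex_unbalanced_equality:
  fixes a :: 'a and c :: "'a divisor \<Rightarrow> 'a" and q :: "'a divisor \<Rightarrow> 'a divisor"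
  assumes a: "irreducible a" and factors: "divisor_factors (prin a) = mset Ps"
    and len: "length Ps \<ge> 3"
    and q: "\<And>P. P \<in> set Ps \<Longrightarrow> prime_divisor (q P)"
    and c: "\<And>P. P \<in> set Ps \<Longrightarrow> c P \<noteq> 0 \<and> prin (c P) = P * q P"
  obtains b where "atomic_equality [a, b] (map c Ps)" "irredundant [a, b] (map c Ps)"
    "unbalanced [a, b] (map c Ps)"
proof -
  let ?qs = "image_mset q (mset Ps)"
  have a0: "a \<noteq> 0" using a by auto
  have P_prime: "prime_divisor P" if "P \<in> set Ps" for P
    using divisor_factors(1)[OF krull, of P "prin a"] that factors by simp
  have P_nonpr: "\<not> principal_divisor P" if "P \<in> set Ps" for P
    using irreducible_prin_subset[OF a, of "{#P#}"] that len by (auto simp: factors dest: arg_cong[of _ _ size])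
  have q_nonpr: "\<not> principal_divisor (q P)" if "P \<in> set Ps" for P
    using P_nonpr[OF that] c[OF that] principal_divisor_cancel[of "q P" P] principal_divisor_prin[of "c P"]
    by (auto simp: mult.commute)
  have c_factors: "divisor_factors (prin (c P)) = {#P, q P#}" if "P \<in> set Ps" for P
    using c[OF that] P_prime[OF that] q[OF that]
    by (simp add: divisor_factors_mult[OF krull] divisor_factors_prime[OF krull])
  have c_irred: "irreducible (c P)" if "P \<in> set Ps" for P
    using c[OF that] c_factors[OF that] P_nonpr[OF that] q_nonpr[OF that]
    by (intro irreducible_if_few_factors) auto
  define z where "z = prod_list (map c Ps)"
  have z0: "z \<noteq> 0" using c by (auto simp: z_def prod_list_zero_iff)
  have "prin z = prod_list (map prin (map c Ps))"
    unfolding z_def using c by (intro prin_prod_list) auto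
  also have "map prin (map c Ps) = map (\<lambda>P. P * q P) Ps" using c by simp
  also have "prod_list \<dots> = prod_mset (image_mset (\<lambda>P. P * q P) (mset Ps))"
    by (metis mset_map prod_mset_prod_list)
  also have "\<dots> = prod_mset (mset Ps) * prod_mset ?qs" by (simp add: prod_mset.distrib)
  also have "prod_mset (mset Ps) = prin a" using divisor_factors(2)[OF krull, of "prin a"] factors by simp
  finally have z: "prin z = prin a * prod_mset ?qs" .
  then have "a dvd z" using a0 z0 by (metis dvd_triv_left prin_dvd_iff)
  then obtain b where b: "z = a * b" by (auto elim: dvdE)
  have b0: "b \<noteq> 0" using b z0 by auto
  have "prin b = prod_mset ?qs"
    using z a0 b0 unfolding b by (simp add: prin_mult prin_mult_cancel)
  then have b_factors: "divisor_factors (prin b) = ?qs"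
    using q by (auto simp: divisor_factors_unique[OF krull])
  \<comment> \<open>A principal part \<open>N\<close> of the \<open>q P\<close> comes from a part
    \<open>M\<close> of the \<open>P\<close>. The product of all \<open>P * q P\<close> over
    \<open>M\<close> is principal, hence so is that of \<open>M\<close>, and \<open>a\<close> being
    an atom leaves only the trivial cases.\<close>
  have b_irred: "irreducible b"
  proof (rule irreducible_prinI[OF b0])
    show "divisor_factors (prin b) \<noteq> {#}" using b_factors len by auto
    fix N assume "N \<subseteq># divisor_factors (prin b)" and pr: "principal_divisor (prod_mset N)"
    then obtain N' where "?qs = N + N'" by (auto simp: b_factors mset_subset_eq_exists_conv)
    then obtain M M' where M: "mset Ps = M + M'" "N = image_mset q M"
      using image_mset_eq_plusD by metis
    have "set_mset M \<subseteq> set Ps" using M(1) by (metis set_mset_mset set_mset_union sup_ge1)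
    then have "principal_divisor (prod_mset (image_mset (\<lambda>P. P * q P) M))"
    proof (induction M)
      case (add P M)
      then have "principal_divisor (P * q P)" using c[of P] principal_divisor_prin[of "c P"] by simp
      then show ?case using add principal_divisor_mult by simp
    qed (simp add: principal_divisor_1)
    then have "principal_divisor (prod_mset N * prod_mset M)"
      by (simp add: prod_mset.distrib M(2) mult.commute)
    then have "principal_divisor (prod_mset M)" using pr principal_divisor_cancel by blast
    then have "M = {#} \<or> M = mset Ps"
      using irreducible_prin_subset[OF a, of M] M(1) factors by simp
    then show "N = {#} \<or> N = divisor_factors (prin b)" using M(2) b_factors by auto
  qed
  \<comment> \<open>Some \<open>c P\<close> would divide the atom \<open>x\<close> and so be
    associated to it; but \<open>c P\<close> has two prime divisors and \<open>x\<close> at least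
    three.\<close>
  have not_assoc: "\<not> associated x (\<Prod>j\<in>J. map c Ps ! j)"
    if x: "irreducible x" "size (divisor_factors (prin x)) = length Ps"
      and J: "J \<noteq> {}" "J \<subset> {..<length Ps}" for x J
  proof
    assume "associated x (\<Prod>j\<in>J. map c Ps ! j)"
    then obtain u where u: "u dvd 1" "(\<Prod>j\<in>J. map c Ps ! j) = u * x" by (auto simp: associated_def)
    obtain j where j: "j \<in> J" using J by blast
    then have j': "j < length Ps" "Ps ! j \<in> set Ps" using J by auto
    have "finite J" using J finite_subset by blast
    then have "map c Ps ! j dvd u * x" using j dvd_prodI unfolding u(2)[symmetric] by blast
    then have "c (Ps ! j) dvd x" using u(1) j' dvd_unit_mult_cancel by simp
    then obtain t where t: "x = c (Ps ! j) * t" by (auto elim: dvdE)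
    then have "t dvd 1" using irreducibleD[OF x(1) t] c_irred[OF j'(2)] by (auto simp: irreducible_def)
    moreover have "t \<noteq> 0" using t x(1) by auto
    ultimately have "divisor_factors (prin x) = {#Ps ! j, q (Ps ! j)#}"
      unfolding t using c[OF j'(2)] c_factors[OF j'(2)]
      by (simp add: divisor_factors_prin_mult flip: divisor_factors_prin_empty_iff)
    then show False using x(2) len by simp
  qed
  show thesis
  proof
    show "atomic_equality [a, b] (map c Ps)"
      using a b_irred c_irred b len by (auto simp: atomic_equality_def z_def)
    show "unbalanced [a, b] (map c Ps)" using len by (simp add: unbalanced_def)
    show "irredundant [a, b] (map c Ps)"
      unfolding irredundant_def
    proof (intro allI impI)
      fix I J assume I: "I \<noteq> {}" "I \<subset> {..<length [a, b]}"
        and J: "J \<noteq> {}" "J \<subset> {..<length (map c Ps)}"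
      have "{..<length [a, b]} = {0, 1}" by auto
      \<comment> \<open>The left side has two factors, so its nonempty proper subproducts are just
        \<open>a\<close> and \<open>b\<close>.\<close>
      with I have "I = {0} \<or> I = {1}" by auto
      moreover have "size (divisor_factors (prin a)) = length Ps"
          "size (divisor_factors (prin b)) = length Ps" by (simp_all add: factors b_factors)
      ultimately show "\<not> associated (\<Prod>i\<in>I. [a, b] ! i) (\<Prod>j\<in>J. map c Ps ! j)"
        using not_assoc[of a J] not_assoc[of b J] a b_irred J by auto
    qed
  qed
qed

context
  assumes classes: "every_class_has_height_one_prime TYPE('a)"
    and large: "\<not> class_group_order_le_2 TYPE('a)"
begin

lemma ex_prime_inverse:
  fixes D :: "'a divisor"
  obtains P a where "prime_divisor P" "a \<noteq> 0" "prin a = D * P"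
proof -
  obtain E where E: "principal_divisor (D * E)" by (rule divisor_inverse_class[OF krull])
  obtain P where P: "prime_divisor P" "divisor_class P = divisor_class E"
    by (rule ex_prime_divisor_in_class[OF krull classes])
  then have "principal_divisor (P * D)"
    using divisor_class_eqD[of E P D] E by (simp add: mult.commute)
  then show thesis using that P by (auto simp: principal_divisor_def mult.commute)
qed

lemma bad_atom_if_several_factors:
  assumes a: "irreducible (a :: 'a)" and several: "size (divisor_factors (prin a)) \<noteq> 1"
  shows "bad_atom a"
proof -
  have "\<exists>Q b. prime_divisor Q \<and> b \<noteq> 0 \<and> prin b = P * Q" for P :: "'a divisor"
    by (metis ex_prime_inverse)
  then obtain q c where qc: "\<And>P :: 'a divisor. prime_divisor (q P) \<and> c P \<noteq> 0 \<and> prin (c P) = P * q P"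
    by metis
  obtain Ps where Ps: "mset Ps = divisor_factors (prin a)" using ex_mset by blast
  have a0: "a \<noteq> 0" using a by auto
  have "divisor_factors (prin a) \<noteq> {#}"
    using a a0 by (auto simp: divisor_factors_prin_empty_iff irreducible_def)
  then have "length Ps \<noteq> 0" using Ps by auto
  moreover have "length Ps \<noteq> 1"
    using several by (metis Ps size_mset)
  ultimately consider "length Ps \<ge> 3" | "length Ps = 2" by linarith
  then show ?thesis
  proof cases
    case 1
    obtain b where "atomic_equality [a, b] (map c Ps)" "irredundant [a, b] (map c Ps)"
        "unbalanced [a, b] (map c Ps)"
      by (rule ex_unbalanced_equality[OF a Ps[symmetric] 1, of q c]) (use qc in auto)
    then show ?thesis using a unfolding bad_atom_def
      by (intro conjI exI[of _ "[a, b]"] exI[of _ "map c Ps"]) auto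
  next
    case 2
    then obtain P P' where PP': "Ps = [P, P']" by (auto simp: length_Suc_conv numeral_2_eq_2)
    have factors: "divisor_factors (prin a) = {#P, P'#}" using Ps PP' by simp
    have P: "prime_divisor P" "prime_divisor P'"
      using divisor_factors(1)[OF krull, of _ "prin a"] by (auto simp: factors)
    have prin_a: "prin a = P * P'"
      using divisor_factors(2)[OF krull, of "prin a"] by (simp add: factors)
    have P_nonpr: "\<not> principal_divisor P"
      using irreducible_prin_subset[OF a, of "{#P#}"] by (auto simp: factors)
    \<comment> \<open>With three or more classes, \<open>Q\<close> can avoid both the trivial class
      and the inverse class of \<open>P\<close>. Completing \<open>P * Q\<close> by \<open>R\<close>
      to a principal divisor then gives an atom with three nonprincipal primes.\<close>
    obtain E where E: "\<not> principal_divisor E" "\<not> principal_divisor (P * E)"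
      by (rule ex_nonprincipal_if_not_order_le_2[OF krull large])
    obtain Q where Q: "prime_divisor Q" "divisor_class Q = divisor_class E"
      by (rule ex_prime_divisor_in_class[OF krull classes])
    then have "\<not> principal_divisor Q" "\<not> principal_divisor (P * Q)"
      using E divisor_class_eqD[of Q E 1] divisor_class_eqD[of Q E P] by (auto simp: mult.commute)
    obtain R a' where R: "prime_divisor R" "a' \<noteq> 0" "prin a' = P * Q * R"
      by (rule ex_prime_inverse)
    have "\<not> principal_divisor R"
      using R(2,3) \<open>\<not> principal_divisor (P * Q)\<close> principal_divisor_prin[of a']
        principal_divisor_cancel[of R "P * Q"] by (auto simp: mult.commute)
    have a'_factors: "divisor_factors (prin a') = mset [P, Q, R]"
      using P Q R by (simp add: divisor_factors_mult[OF krull] divisor_factors_prime[OF krull])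
    have a'_irred: "irreducible a'"
      using R(2) P_nonpr \<open>\<not> principal_divisor Q\<close> \<open>\<not> principal_divisor R\<close>
      by (intro irreducible_if_few_factors) (auto simp: a'_factors)
    \<comment> \<open>Since \<open>prin a = P * P'\<close>, the pair \<open>P'\<close>,
      \<open>a\<close> is an admissible choice of partner and atom at \<open>P\<close>; this places
      \<open>a\<close> on the right-hand side.\<close>
    obtain b where "atomic_equality [a', b] (map (c(P := a)) [P, Q, R])"
        "irredundant [a', b] (map (c(P := a)) [P, Q, R])"
        "unbalanced [a', b] (map (c(P := a)) [P, Q, R])"
      by (rule ex_unbalanced_equality[OF a'_irred a'_factors, of "q(P := P')" "c(P := a)"])
        (use qc P a0 prin_a in auto)
    then show ?thesis using a unfolding bad_atom_def
      by (intro conjI exI[of _ "[a', b]"] exI[of _ "map (c(P := a)) [P, Q, R]"]) auto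
  qed
qed

text \<open>This rules out unique factorization: a unique factorization domain is half-factorial and
  has no bad atoms.\<close>

lemma ex_bad_atom: "\<exists>a :: 'a. bad_atom a"
proof -
  obtain E :: "'a divisor" where E: "\<not> principal_divisor E"
    using ex_nonprincipal_if_not_order_le_2[OF krull large, of 1] by blast
  obtain P where P: "prime_divisor P" "divisor_class P = divisor_class E"
    by (rule ex_prime_divisor_in_class[OF krull classes])
  then have P_nonpr: "\<not> principal_divisor P"
    using E divisor_class_eqD[of P E 1] by auto
  obtain Q a where Q: "prime_divisor Q" "a \<noteq> 0" "prin a = P * Q"
    by (rule ex_prime_inverse)
  have Q_nonpr: "\<not> principal_divisor Q"
    using P_nonpr Q principal_divisor_cancel[of Q P] principal_divisor_prin[of a]
    by (auto simp: mult.commute)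
  have factors: "divisor_factors (prin a) = {#P, Q#}"
    using P Q by (simp add: divisor_factors_mult[OF krull] divisor_factors_prime[OF krull])
  have "irreducible a"
    using Q(2) P_nonpr Q_nonpr by (intro irreducible_if_few_factors) (auto simp: factors)
  then have "bad_atom a" by (rule bad_atom_if_several_factors) (simp add: factors)
  then show ?thesis ..
qed

end

end

subsection \<open>Half-factorial domains\<close>

text \<open>An unbalanced atomic equality displays two factorizations of different lengths of one
  nonzero nonunit.\<close>

lemma half_factorial_imp_not_bad:
  assumes hfd: "half_factorial_domain TYPE('a::idom)"
  shows "\<not> bad_atom (a :: 'a)"
proof
  assume "bad_atom a"
  then obtain as bs :: "'a list" where eq: "atomic_equality as bs" "unbalanced as bs"
    by (auto simp: bad_atom_def)
  let ?x = "prod_list as"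
  have as: "factorization_of (mset as) ?x" "factorization_of (mset bs) ?x"
    using eq by (auto simp: atomic_equality_def factorization_of_def prod_mset_prod_list)
  moreover have "0 \<notin> set as" using eq by (auto simp: atomic_equality_def irreducible_def)
  then have "?x \<noteq> 0" by (simp add: prod_list_zero_iff)
  moreover have "\<not> ?x dvd 1"
  proof
    assume "?x dvd 1"
    moreover have "as \<noteq> []" using eq by (simp add: atomic_equality_def)
    then have "hd as dvd ?x" by (cases as) simp_all
    ultimately have "hd as dvd 1" by (rule dvd_trans[rotated])
    then show False using eq by (cases as) (auto simp: atomic_equality_def irreducible_def)
  qed
  ultimately have "size (mset as) = size (mset bs)"
    using hfd unfolding half_factorial_domain_def by blast
  then show False using eq by (simp add: unbalanced_def)
qed

lemma unique_factorization_imp_half_factorial: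
  "unique_factorization_domain TYPE('a::idom) \<Longrightarrow> half_factorial_domain TYPE('a)"
  unfolding unique_factorization_domain_def half_factorial_domain_def
  by (metis rel_mset_size)

text \<open>Primes are cancelled one at a time. The unit \<open>w\<close> is generalized in the
  induction to absorb the unit \<open>t\<close> with \<open>q = p * t\<close>.\<close>

lemma rel_mset_associated_if_prime:
  fixes F G :: "'a::idom multiset"
  assumes "\<forall>p\<in>#F. prime_elem p" "\<forall>p\<in>#G. irreducible p"
    and "prod_mset F * u = prod_mset G * w" "u dvd 1" "w dvd 1"
  shows "rel_mset associated F G"
  using assms
proof (induction F arbitrary: G w)
  case empty
  then have "prod_mset G dvd 1"
    by (metis dvd_triv_left dvd_trans mult_1 prod_mset_empty)
  then have "G = {#}"
  proof (cases G)
    case (add p H)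
    then have "p dvd 1" using \<open>prod_mset G dvd 1\<close> by (auto dest: dvd_mult_left)
    then show ?thesis using empty.prems(2) add by (auto simp: irreducible_def)
  qed simp
  then show ?case by (simp add: rel_mset_Zero)
next
  case (add p F)
  have p: "prime_elem p" using add.prems by simp
  have "p dvd prod_mset G * w" using add.prems(3) by (metis dvd_triv_left mult.assoc prod_mset.add_mset)
  then have "p dvd prod_mset G" using add.prems(5) dvd_unit_mult_cancel by (metis mult.commute)
  then have "\<exists>q\<in>#G. p dvd q"
    by (induction G) (use p in \<open>auto simp: prime_elem_def\<close>)
  then obtain q where q: "q \<in># G" "p dvd q" by blast
  then obtain t where t: "q = p * t" by (auto elim: dvdE)
  have "irreducible q" using q add.prems by simp
  then have t1: "t dvd 1" using irreducibleD[OF _ t] p by (auto simp: prime_elem_def)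
  obtain G' where G': "G = add_mset q G'" using q by (meson multi_member_split)
  have "p * (prod_mset F * u) = p * (prod_mset G' * (t * w))"
    using add.prems(3) unfolding G' t by (simp add: mult_ac)
  then have "prod_mset F * u = prod_mset G' * (t * w)" using p by simp
  moreover have "t * w dvd 1" using mult_dvd_mono[OF t1 add.prems(5)] by simp
  ultimately have "rel_mset associated F G'"
    using add.prems G' by (intro add.IH[of G' "t * w"]) auto
  moreover have "associated p q" using t t1 by (auto simp: associated_def mult.commute)
  ultimately show ?case unfolding G' by (intro rel_mset_Plus)
qed

lemma unique_factorization_if_atoms_prime:
  assumes "atomic_domain TYPE('a::idom)" "\<And>a::'a. irreducible a \<Longrightarrow> prime_elem a"
  shows "unique_factorization_domain TYPE('a)"
  unfolding unique_factorization_domain_def factorization_of_def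
  using assms rel_mset_associated_if_prime[where u = 1 and w = 1 and 'a = 'a] by auto

theorem proposition7:
  fixes i ii iii :: bool
  defines "i \<equiv> finite (carrier (divisor_class_group :: 'a::idom fract set set monoid)) \<and>
                Coset.order (divisor_class_group :: 'a fract set set monoid) \<le> 2"
    and "ii \<equiv> half_factorial_domain TYPE('a)"
    and "iii \<equiv> unique_factorization_domain TYPE('a) \<or>
                (\<exists>a::'a. good_atom a \<and> \<not> prime_elem a)"
  assumes "krull_domain TYPE('a)"
  shows "(i \<longrightarrow> ii) \<and> (ii \<longrightarrow> iii) \<and>
         (every_class_has_height_one_prime TYPE('a) \<longrightarrow> (i \<longleftrightarrow> ii) \<and> (ii \<longleftrightarrow> iii))"
proof -
  have i_iff: "i \<longleftrightarrow> class_group_order_le_2 TYPE('a)"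
    unfolding i_def Coset.order_def carrier_divisor_class_group ..
  have i_ii: "i \<longrightarrow> ii"
    unfolding i_iff ii_def using half_factorial_if_order_le_2[OF assms(4)] by blast
  \<comment> \<open>No atom is bad, so either some nonprime atom is good, or all atoms are prime and
    factorization is unique.\<close>
  have ii_iii: "ii \<longrightarrow> iii"
    unfolding ii_def iii_def good_atom_def
    using half_factorial_imp_not_bad unique_factorization_if_atoms_prime krull_atomic[OF assms(4)]
    by blast
  have iii_i: "iii \<longrightarrow> i" if classes: "every_class_has_height_one_prime TYPE('a)"
  proof (rule impI, rule ccontr)
    assume iii and "\<not> i"
    then have large: "\<not> class_group_order_le_2 TYPE('a)" unfolding i_iff by blast
    have bad: "bad_atom a" if "irreducible a" "\<not> prime_elem a" for a :: 'a
    proof (rule bad_atom_if_several_factors[OF assms(4) classes large that(1)])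
      have "a \<noteq> 0" using that by auto
      then show "size (divisor_factors (prin a)) \<noteq> 1"
        using prime_elem_if_single_factor[OF assms(4)] that by blast
    qed
    \<comment> \<open>This leaves the second alternative of \<open>iii\<close>, a good nonprime
      atom, which \<open>bad\<close> excludes.\<close>
    have "\<not> unique_factorization_domain TYPE('a)"
      using ex_bad_atom[OF assms(4) classes large] half_factorial_imp_not_bad
        unique_factorization_imp_half_factorial by blast
    then show False using \<open>iii\<close> bad unfolding iii_def good_atom_def by blast
  qed
  show ?thesis using i_ii ii_iii iii_i by blast
qed

end
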